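(* Let $0<\alpha<1$, $L>0$, $k>0$, $\bar d>0$, and let $G$ be an undirected and connected graph with $N$ nodes and adjacency matrix $A=(a_{ij})$. Consider the multi-agent system, for $x\in[0,L]$, $t\ge 0$, $i=1,\dots,N$, $$y_{i,t}(x,t)=k\,y_{i,xx}(x,t)+u_i(x,t)+d_i(x,t),\qquad y_i(0,t)=y_i(L,t)=0,\qquad y_i(x,0)=y_i^0(x),$$ where each $y_i^0$ is bounded and continuous on $[0,L]$, each disturbance $d_i$ is continuous in $x$ and $t$ and satisfies $|d_i(x,t)|\le d_{\max}$ for all $x\in[0,L]$, $t\in[0,\infty)$, with $d_{\max}$ a known constant. With $\xi_{ij}(x,t)=y_i(x,t)-y_j(x,t)$, let the controller be $$u_i(x,t)=-\sum_{j=1}^{N}a_{ij}\left(\int_0^L\xi_{ij}(x,t)^{2}\,\mathrm{d}x\right)^{\alpha-1}\xi_{ij}(x,t)-\bar d\sum_{j=1}^{N}a_{ij}\,\mathrm{sign}(\xi_{ij}(x,t)).$$ Let $E=(a_{ij}^2)\in\mathbb{R}^{N\times N}$ and $B=(a_{ij}^{1/\alpha})\in\mathbb{R}^{N\times N}$. If $$\bar d\ge\frac{2d_{\max}N^{1/2}}{\sqrt2\,\lambda_2(\mathcal{L}(E))^{1/2}},$$ then the system achieves finite-time consensus, and the finite terminal time $t^*$ satisfies $$t^*\le\frac{\left[\int_0^L\frac{1}{2N}\sum_{i,j=1}^{N}(y_i^0(x)-y_j^0(x))^2\,\mathrm{d}x\right]^{1-\alpha}}{C_1(1-\alpha)},\qquad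 C_1=\left(2\lambda_2(\mathcal{L}(B))\right)^{\alpha}.$$
   Context: Graph: $G=\{\mathfrak V,\mathfrak E,A\}$ has vertices $v_1,\dots,v_N$ and nonnegative adjacency matrix $A=(a_{ij})$, with $a_{ij}>0$ if node $v_i$ can receive data from $v_j$ (i.e. $(v_j,v_i)\in\mathfrak E$, $v_j\in N_i$), and $a_{ij}=0$ otherwise. Undirected means $a_{ij}=a_{ji}$. An undirected graph is connected if for any pair $v_i,v_j$ there is a sequence $a_{ii_1},a_{i_1i_2},\dots,a_{i_mj}$ all of whose elements are positive. Laplacian: for a nonnegative matrix $M=(m_{ij})$ viewed as an adjacency matrix, $\mathcal L(M)=(l_{ij})$ with $l_{ij}=-m_{ij}$ for $j\neq i$ and $l_{ii}=\sum_{j\ne i}m_{ij}$. For symmetric $\mathcal L(M)$, $\lambda_2(\mathcal L(M))=\min_{x\ne0,\ \langle x,\mathbf 1\rangle=0}\frac{\langle x,\mathcal L(M)x\rangle}{\langle x,x\rangle}$, the second smallest eigenvalue, where $\mathbf 1=[1,\dots,1]^T$. Finite-time consensus (FTC): the system achieves FTC if there exists a finite time $t^*$ such that $\lim_{t\to t^*}|y_i(x,t)-y_j(x,t)|=0$ for any $x\in[0,L]$ and $i,j=1,\dots,N$. This $t^*$ is the terminal time. Subscripts $t$, $xx$ denote partial derivatives. The term $\left(\int_0^L\xi_{ij}^2\,\mathrm dx\right)^{\alpha-1}\xi_{ij}$ is read as $0$ when $\xi_{ij}(\cdot,t)\equiv0$ (in particular for $i=j$). *)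

theory Defs
  imports "HOL-Analysis.Analysis"
begin

text \<open>
  Nodes are the elements of a finite type \<open>'n\<close>, so \<open>N = CARD('n)\<close>; a family of agents
  is a function \<open>y :: 'n \<Rightarrow> real \<Rightarrow> real \<Rightarrow> real\<close>, with \<open>y i x t\<close> standing for $y_i(x,t)$.
\<close>

definition undirected_adjacency :: "real^'n^'n \<Rightarrow> bool" where
  "undirected_adjacency A \<longleftrightarrow> (\<forall>i j. 0 \<le> A $ i $ j \<and> A $ i $ j = A $ j $ i)"

definition connected_adjacency :: "real^'n^'n \<Rightarrow> bool" where
  "connected_adjacency A \<longleftrightarrow> (\<forall>i j. i \<noteq> j \<longrightarrow> tranclp (\<lambda>p q. 0 < A $ p $ q) i j)"

definition laplacian :: "real^'n^'n \<Rightarrow> real^'n^'n" where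
  "laplacian M = (\<chi> i j. if i = j then (\<Sum>m\<in>UNIV - {i}. M $ i $ m) else - (M $ i $ j))"

text \<open>
  The infimum is attained (the quotient is continuous and homogeneous of degree 0) as soon as
  there are at least two nodes. The vector \<open>1 :: real^'n\<close> has all entries 1.
\<close>

definition lambda2 :: "real^'n^'n \<Rightarrow> real" where
  "lambda2 M = (INF x\<in>{x. x \<noteq> 0 \<and> x \<bullet> 1 = 0}. (x \<bullet> (M *v x)) / (x \<bullet> x))"

definition xi :: "('n \<Rightarrow> real \<Rightarrow> real \<Rightarrow> real) \<Rightarrow> 'n \<Rightarrow> 'n \<Rightarrow> real \<Rightarrow> real \<Rightarrow> real" where
  "xi y i j x t = y i x t - y j x t"

text \<open>
  \<open>s i j x t\<close> is the value of $\mathrm{sign}(\xi_{ij}(x,t))$ that enters the equation. Because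
  the sign is discontinuous, the closed-loop equation is understood as a Filippov-type inclusion:
  where $\xi_{ij}$ vanishes, any value in $[-1,1]$ is admitted, subject to
  $\mathrm{sign}(\xi_{ji}) = -\mathrm{sign}(\xi_{ij})$. With the convention
  $\mathrm{sign}(0) = 0$ alone there would in general be no solution: once
  $y_i = y_j$ for all $i,j$, the control would vanish and all the disturbances would have to
  agree. That convention is the special case of the lemma below.
\<close>

definition sign_values ::
  "('n \<Rightarrow> real \<Rightarrow> real \<Rightarrow> real) \<Rightarrow> ('n \<Rightarrow> 'n \<Rightarrow> real \<Rightarrow> real \<Rightarrow> real) \<Rightarrow> bool" where
  "sign_values y s \<longleftrightarrow>
     (\<forall>i j x t. (xi y i j x t \<noteq> 0 \<longrightarrow> s i j x t = sgn (xi y i j x t)) \<and>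
                \<bar>s i j x t\<bar> \<le> 1 \<and> s j i x t = - s i j x t)"

lemma sign_values_sgn: "sign_values y (\<lambda>i j x t. sgn (xi y i j x t))"
  unfolding sign_values_def xi_def by (auto simp: sgn_real_def)

text \<open>
  Since \<open>0 powr (\<alpha> - 1) = 0\<close>, the nonlinear term is 0 when \<open>xi y i j\<close> vanishes
  identically at time \<open>t\<close>.
\<close>

definition controller ::
  "real^'n^'n \<Rightarrow> real \<Rightarrow> real \<Rightarrow> real \<Rightarrow> ('n \<Rightarrow> 'n \<Rightarrow> real \<Rightarrow> real \<Rightarrow> real)
     \<Rightarrow> ('n \<Rightarrow> real \<Rightarrow> real \<Rightarrow> real) \<Rightarrow> 'n \<Rightarrow> real \<Rightarrow> real \<Rightarrow> real" where
  "controller A \<alpha> dbar L s y i x t =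
     - (\<Sum>j\<in>UNIV. A $ i $ j * (integral {0..L} (\<lambda>z. (xi y i j z t)\<^sup>2)) powr (\<alpha> - 1) * xi y i j x t)
     - dbar * (\<Sum>j\<in>UNIV. A $ i $ j * s i j x t)"

text \<open>
  \<open>g\<close> is locally absolutely continuous on the interval \<open>S\<close> and \<open>g'\<close> is its almost everywhere
  derivative.
\<close>

definition ac_derivative :: "(real \<Rightarrow> real) \<Rightarrow> (real \<Rightarrow> real) \<Rightarrow> real set \<Rightarrow> bool" where
  "ac_derivative g g' S \<longleftrightarrow>
     (\<forall>a b. a \<le> b \<and> {a..b} \<subseteq> S \<longrightarrow>
        set_integrable lborel {a..b} g' \<and> g b - g a = (LINT s:{a..b}|lborel. g' s))"

definition locally_L2 :: "real \<Rightarrow> (real \<Rightarrow> real \<Rightarrow> real) \<Rightarrow> bool" where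
  "locally_L2 L v \<longleftrightarrow>
     (\<lambda>(x, t). v x t) \<in> borel_measurable borel \<and>
     (\<forall>a b. 0 < a \<longrightarrow> set_integrable lborel ({0..L} \<times> {a..b}) (\<lambda>(x, t). (v x t)\<^sup>2))"

text \<open>
  Strong solutions of $y_{i,t} = k y_{i,xx} + f_i$ with homogeneous Dirichlet conditions and
  initial values $y_i^0$. The right-hand side is discontinuous in the state, so the second
  derivative has jumps where some $\xi_{ij}$ changes sign, and the equation can only be asked to
  hold almost everywhere; \<open>yt\<close>, \<open>yx\<close>, \<open>yxx\<close> are the partial derivatives (with the first and
  the last one square integrable on $[0,L] \times [a,b]$ for $0 < a < b$). The initial value is
  attained in $L^2(0,L)$ and the boundary condition is imposed for $t > 0$, so that
  $y_i^0$ need not vanish at the end points.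
\<close>

definition strong_solution ::
  "real \<Rightarrow> real \<Rightarrow> ('n \<Rightarrow> real \<Rightarrow> real \<Rightarrow> real) \<Rightarrow> ('n \<Rightarrow> real \<Rightarrow> real)
     \<Rightarrow> ('n \<Rightarrow> real \<Rightarrow> real \<Rightarrow> real) \<Rightarrow> bool" where
  "strong_solution k L f y0 y \<longleftrightarrow>
     (\<forall>i. continuous_on ({0..L} \<times> {0<..}) (\<lambda>(x, t). y i x t) \<and>
          (\<forall>t>0. y i 0 t = 0 \<and> y i L t = 0) \<and>
          (\<forall>x\<in>{0..L}. y i x 0 = y0 i x) \<and>
          ((\<lambda>t. integral {0..L} (\<lambda>x. (y i x t - y0 i x)\<^sup>2)) \<longlongrightarrow> 0) (at_right 0) \<and>
          (\<exists>yt yx yxx.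
             locally_L2 L yt \<and> locally_L2 L yxx \<and>
             (AE x in lborel. x \<in> {0..L} \<longrightarrow> ac_derivative (\<lambda>t. y i x t) (\<lambda>t. yt x t) {0<..}) \<and>
             (AE t in lborel. t > 0 \<longrightarrow>
                ac_derivative (\<lambda>x. y i x t) (\<lambda>x. yx x t) {0..L} \<and>
                ac_derivative (\<lambda>x. yx x t) (\<lambda>x. yxx x t) {0..L}) \<and>
             (AE (x, t) in lborel. x \<in> {0..L} \<and> t > 0 \<longrightarrow>
                yt x t = k * yxx x t + f i x t)))"

text \<open>The limit is taken within the time domain, hence from the right if \<open>ts = 0\<close>.\<close>

definition consensus_time :: "real \<Rightarrow> ('n \<Rightarrow> real \<Rightarrow> real \<Rightarrow> real) \<Rightarrow> real \<Rightarrow> bool" where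
  "consensus_time L y ts \<longleftrightarrow>
     0 \<le> ts \<and>
     (\<forall>x\<in>{0..L}. \<forall>i j. ((\<lambda>t. \<bar>y i x t - y j x t\<bar>) \<longlongrightarrow> 0) (at ts within {0..}))"

definition finite_time_consensus :: "real \<Rightarrow> ('n \<Rightarrow> real \<Rightarrow> real \<Rightarrow> real) \<Rightarrow> bool" where
  "finite_time_consensus L y \<longleftrightarrow> (\<exists>ts. consensus_time L y ts)"

end

theory Submission
  imports Defs
begin

text \<open>
  Let \<open>W i j t\<close> be the squared $L^2$ norm of $\xi_{ij}(\cdot,t)$ and
  \<open>V t = 1/(2N) * (\<Sum>i j. W i j t)\<close>. Testing the equations with the deviations from the mean,
  the diffusion contributes a nonpositive term, the sliding term
  \<open>dbar * (\<Sum>i j. a i j * \<bar>\<xi> i j\<bar>)\<close> absorbs the disturbances (by Cauchy-Schwarz and the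
  variational characterisation of $\lambda_2(\mathcal L(E))$), and what remains is
  \<open>V' \<le> - (\<Sum>i j. a i j * W i j powr \<alpha>)\<close>. Since \<open>\<lambda>r. r powr \<alpha>\<close> is subadditive, the sum is at least
  \<open>(\<Sum>i j. a i j powr (1/\<alpha>) * W i j) powr \<alpha> \<ge> (2 * \<lambda>\<^sub>2(L(B)) * V) powr \<alpha>\<close>, so that
  \<open>V powr (1 - \<alpha>)\<close> decreases at least at the rate \<open>C\<^sub>1 * (1 - \<alpha>)\<close> until it vanishes.
\<close>

text \<open>The equation holds only almost everywhere and the initial data are attained only in
  \<open>L2\<close>, so \<open>V\<close> is never differentiated. Its decay is proved in the
  integrated form \<open>V b - V a \<le> - C * integral {a..b} (\<lambda>t. V t powr
  \<alpha>)\<close> for \<open>0 < a \<le> b\<close>, and \<open>a\<close> is sent to 0 afterwards.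
  This takes integration by parts for absolutely continuous functions, in \<open>x\<close> for the
  diffusion and in \<open>t\<close> for the energy, and Fubini's theorem to pass from the rectangle
  to almost every time.

  The two auxiliary matrices have different origins. Squared weights appear because the l1 norm of
  the numbers \<open>a i j * \<bar>\<xi> i j\<bar>\<close> dominates their l2 norm, whose square is
  twice the Laplacian form with weights \<open>(a i j)^2\<close>. The exponent
  \<open>1/\<alpha>\<close> brings the weight under the power: \<open>a * W powr \<alpha> = (a powr
  (1/\<alpha>) * W) powr \<alpha>\<close>.

  Extinction of \<open>V\<close> is an \<open>L2\<close> statement; continuity in \<open>x\<close>
  turns it into agreement at every point, and continuity in \<open>t\<close> into a limit at the
  terminal time.\<close>

lemma powr_sum_le:
  fixes f :: "'i \<Rightarrow> real"
  assumes "finite I" "\<And>i. i \<in> I \<Longrightarrow> 0 \<le> f i" "0 < \<alpha>" "\<alpha> \<le> 1"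
  shows "(\<Sum>i\<in>I. f i) powr \<alpha> \<le> (\<Sum>i\<in>I. f i powr \<alpha>)"
proof (cases "(\<Sum>i\<in>I. f i) = 0")
  case True
  then show ?thesis by (simp add: sum_nonneg)
next
  case False
  define S where "S = (\<Sum>i\<in>I. f i)"
  have S: "0 < S" using False assms(2) unfolding S_def by (metis sum_nonneg order_le_less)
  \<comment> \<open>After division by the total every term lies in [0,1], where
    \<open>r \<le> r powr \<alpha>\<close>, and the normalised terms add up to 1.\<close>
  have le: "f i / S \<le> f i powr \<alpha> / S powr \<alpha>" if "i \<in> I" for i
  proof -
    have "f i \<le> S" unfolding S_def using assms(1,2) that by (intro member_le_sum) auto
    then have "(f i / S) powr 1 \<le> (f i / S) powr \<alpha>"
      using assms(2)[OF that] S assms(4) by (intro powr_mono') auto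
    then show ?thesis using assms(2)[OF that] S by (simp add: powr_divide)
  qed
  have "1 = (\<Sum>i\<in>I. f i / S)" using S unfolding S_def by (simp flip: sum_divide_distrib)
  also have "\<dots> \<le> (\<Sum>i\<in>I. f i powr \<alpha> / S powr \<alpha>)" by (intro sum_mono le)
  also have "\<dots> = (\<Sum>i\<in>I. f i powr \<alpha>) / S powr \<alpha>" by (simp flip: sum_divide_distrib)
  finally show ?thesis using S by (simp add: S_def field_simps)
qed

text \<open>Summation by parts on a graph: exchanging the two indices and using antisymmetry trades
  \<open>v i\<close> for \<open>- v j\<close>. It turns sums over nodes into sums over edges, for
  the Laplacian, the coupling and the sign term alike.\<close>

lemma sum_antisym_pairing:
  fixes v :: "'i \<Rightarrow> real"
  assumes "\<And>i j. g j i = - g i j"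
  shows "2 * (\<Sum>i\<in>I. v i * (\<Sum>j\<in>I. g i j)) = (\<Sum>i\<in>I. \<Sum>j\<in>I. (v i - v j) * g i j)"
proof -
  have "(\<Sum>i\<in>I. \<Sum>j\<in>I. v j * g i j) = (\<Sum>i\<in>I. \<Sum>j\<in>I. v i * g j i)"
    by (rule sum.swap)
  also have "\<dots> = - (\<Sum>i\<in>I. \<Sum>j\<in>I. v i * g i j)"
    by (subst assms) (simp add: sum_negf)
  finally show ?thesis
    by (simp add: sum_distrib_left left_diff_distrib sum_subtractf sum.distrib)
qed

subsection \<open>Graph Laplacians and \<open>lambda2\<close>\<close>

lemma laplacian_mult_nth:
  "(laplacian M *v x) $ i = (\<Sum>j\<in>UNIV. M $ i $ j * (x $ i - x $ j))"
proof -
  have "(laplacian M *v x) $ i = (\<Sum>m\<in>UNIV - {i}. M $ i $ m) * x $ i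
      + (\<Sum>j\<in>UNIV - {i}. - M $ i $ j * x $ j)"
    unfolding matrix_vector_mult_def laplacian_def
    by (simp add: sum.remove[of UNIV i])
  also have "\<dots> = (\<Sum>j\<in>UNIV - {i}. M $ i $ j * (x $ i - x $ j))"
    by (simp add: sum_distrib_right sum_negf right_diff_distrib sum_subtractf)
  also have "\<dots> = (\<Sum>j\<in>UNIV. M $ i $ j * (x $ i - x $ j))"
    by (simp add: sum.remove[of UNIV i])
  finally show ?thesis .
qed

lemma laplacian_quadratic_form:
  assumes "\<And>i j. M $ i $ j = M $ j $ i"
  shows "x \<bullet> (laplacian M *v x) = 1/2 * (\<Sum>i\<in>UNIV. \<Sum>j\<in>UNIV. M $ i $ j * (x $ i - x $ j)\<^sup>2)"
proof -
  have "2 * (x \<bullet> (laplacian M *v x))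
      = 2 * (\<Sum>i\<in>UNIV. x $ i * (\<Sum>j\<in>UNIV. M $ i $ j * (x $ i - x $ j)))"
    by (simp add: inner_vec_def laplacian_mult_nth)
  also have "\<dots> = (\<Sum>i\<in>UNIV. \<Sum>j\<in>UNIV. (x $ i - x $ j) * (M $ i $ j * (x $ i - x $ j)))"
    by (rule sum_antisym_pairing) (subst assms, simp add: algebra_simps)
  also have "\<dots> = (\<Sum>i\<in>UNIV. \<Sum>j\<in>UNIV. M $ i $ j * (x $ i - x $ j)\<^sup>2)"
    by (simp add: power2_eq_square mult_ac)
  finally show ?thesis by simp
qed

text \<open>The orthogonal projection onto the complement of the constant vectors, which is where
  the quotient in \<open>lambda2\<close> is taken. Differences do not change, so it can be inserted
  into any sum over edges.\<close>

definition centered :: "('n::finite \<Rightarrow> real) \<Rightarrow> 'n \<Rightarrow> real" where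
  "centered v i = v i - (\<Sum>j\<in>UNIV. v j) / real CARD('n)"

lemma centered_diff: "centered v i - centered v j = v i - v j"
  by (simp add: centered_def)

lemma sum_diff_eq_centered:
  fixes v :: "'n::finite \<Rightarrow> real"
  shows "(\<Sum>j\<in>UNIV. v i - v j) = real CARD('n) * centered v i"
  by (simp add: centered_def sum_subtractf right_diff_distrib)

lemma sum_centered: "(\<Sum>i\<in>UNIV. centered v i) = 0"
  by (simp add: centered_def sum_subtractf)

text \<open>The variance identity. It explains the factor \<open>1/(2N)\<close> in the energy: the
  energy is the integral of the squared distance to the mean.\<close>

lemma sum_centered_square:
  fixes v :: "'n::finite \<Rightarrow> real"
  shows "(\<Sum>i\<in>UNIV. (centered v i)\<^sup>2)
    = 1 / (2 * real CARD('n)) * (\<Sum>i\<in>UNIV. \<Sum>j\<in>UNIV. (v i - v j)\<^sup>2)"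
proof -
  have "2 * (\<Sum>i\<in>UNIV. centered v i * (\<Sum>j\<in>UNIV. v i - v j))
      = (\<Sum>i\<in>UNIV. \<Sum>j\<in>UNIV. (centered v i - centered v j) * (v i - v j))"
    by (rule sum_antisym_pairing) simp
  then have "2 * real CARD('n) * (\<Sum>i\<in>UNIV. (centered v i)\<^sup>2)
      = (\<Sum>i\<in>UNIV. \<Sum>j\<in>UNIV. (v i - v j)\<^sup>2)"
    by (simp add: sum_diff_eq_centered centered_diff power2_eq_square sum_distrib_left mult_ac)
  then show ?thesis by (simp add: field_simps)
qed

text \<open>A Poincare inequality on the graph: the centered vector competes in the infimum, unless
  it is 0 and both sides vanish. Nonnegative weights bound the quotients below, so that the
  real-valued infimum really is a lower bound.\<close>

lemma lambda2_laplacian_le: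
  fixes v :: "'n::finite \<Rightarrow> real" and M :: "real^'n^'n"
  assumes "undirected_adjacency M"
  shows "lambda2 (laplacian M) * (\<Sum>i\<in>UNIV. (centered v i)\<^sup>2)
    \<le> 1/2 * (\<Sum>i\<in>UNIV. \<Sum>j\<in>UNIV. M $ i $ j * (v i - v j)\<^sup>2)"
proof -
  have M: "0 \<le> M $ i $ j" "M $ i $ j = M $ j $ i" for i j
    using assms by (auto simp: undirected_adjacency_def)
  define x :: "real^'n" where "x = (\<chi> i. centered v i)"
  have x1: "x \<bullet> 1 = 0" by (simp add: x_def inner_vec_def sum_centered)
  have xx: "x \<bullet> x = (\<Sum>i\<in>UNIV. (centered v i)\<^sup>2)"
    by (simp add: x_def inner_vec_def power2_eq_square)
  have q: "x \<bullet> (laplacian M *v x) = 1/2 * (\<Sum>i\<in>UNIV. \<Sum>j\<in>UNIV. M $ i $ j * (v i - v j)\<^sup>2)"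
    by (subst laplacian_quadratic_form[OF M(2)]) (simp add: x_def centered_diff)
  show ?thesis
  proof (cases "x = 0")
    case True
    then have "x \<bullet> x = 0" "x \<bullet> (laplacian M *v x) = 0" by simp_all
    then show ?thesis using xx q by (metis mult_zero_right order_refl)
  next
    case False
    have "lambda2 (laplacian M) \<le> (x \<bullet> (laplacian M *v x)) / (x \<bullet> x)"
      unfolding lambda2_def
    proof (rule cINF_lower)
      show "bdd_below ((\<lambda>x. x \<bullet> (laplacian M *v x) / (x \<bullet> x)) ` {x. x \<noteq> 0 \<and> x \<bullet> 1 = 0})"
      proof (intro bdd_belowI[of _ 0])
        fix r assume "r \<in> (\<lambda>x. x \<bullet> (laplacian M *v x) / (x \<bullet> x)) ` {x. x \<noteq> 0 \<and> x \<bullet> 1 = 0}"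
        then show "0 \<le> r"
          by (auto simp: laplacian_quadratic_form[OF M(2)] intro!: divide_nonneg_nonneg sum_nonneg mult_nonneg_nonneg M(1))
      qed
    qed (use False x1 in auto)
    then have "lambda2 (laplacian M) * (x \<bullet> x) \<le> x \<bullet> (laplacian M *v x)"
      using False by (simp add: pos_le_divide_eq)
    then show ?thesis using xx q by simp
  qed
qed

lemma inner_vec_const_one: "(\<chi> _. c) \<bullet> (1 :: real^'n) = real CARD('n) * c"
  by (simp add: inner_vec_def)

text \<open>Positive quotients could still have infimum 0. Homogeneity of degree 0 reduces them to
  unit vectors orthogonal to \<open>1\<close>, a compact set on which the form attains its minimum.
  That minimum is positive: a zero of the form is constant along edges, hence constant by
  connectedness, hence 0 by orthogonality to \<open>1\<close>. Two distinct nodes are required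
  because for a single node the infimum runs over the empty set.\<close>

lemma lambda2_laplacian_pos:
  fixes M :: "real^'n^'n"
  assumes "undirected_adjacency M" "connected_adjacency M" "(i0::'n) \<noteq> j0"
  shows "0 < lambda2 (laplacian M)"
proof -
  have M: "0 \<le> M $ i $ j" "M $ i $ j = M $ j $ i" for i j
    using assms by (auto simp: undirected_adjacency_def)
  define q where "q = (\<lambda>x. x \<bullet> (laplacian M *v x))"
  have q: "q x = 1/2 * (\<Sum>i\<in>UNIV. \<Sum>j\<in>UNIV. M $ i $ j * (x $ i - x $ j)\<^sup>2)" for x
    unfolding q_def by (rule laplacian_quadratic_form[OF M(2)])
  have q_pos: "0 < q x" if "x \<noteq> 0" "x \<bullet> 1 = 0" for x
  proof (rule ccontr)
    assume "\<not> 0 < q x"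
    moreover have "0 \<le> q x" unfolding q by (intro mult_nonneg_nonneg sum_nonneg M(1)) auto
    ultimately have "(\<Sum>i\<in>UNIV. \<Sum>j\<in>UNIV. M $ i $ j * (x $ i - x $ j)\<^sup>2) = 0"
      unfolding q by linarith
    then have "M $ i $ j * (x $ i - x $ j)\<^sup>2 = 0" for i j
      by (simp add: sum_nonneg_eq_0_iff sum_nonneg M(1))
    then have edge: "x $ i = x $ j" if "0 < M $ i $ j" for i j
      using that by (metis eq_iff_diff_eq_0 less_irrefl mult_eq_0_iff power2_eq_square)
    have "x $ i = x $ j" for i j
    proof (cases "i = j")
      case False
      then have "tranclp (\<lambda>p q. 0 < M $ p $ q) i j"
        using assms(2) by (auto simp: connected_adjacency_def)
      then show ?thesis by (induction rule: tranclp_induct) (auto dest: edge)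
    qed auto
    then have "x = (\<chi> _. x $ i)" for i by (simp add: vec_eq_iff)
    then have "x \<bullet> 1 = real CARD('n) * x $ i" for i
      using inner_vec_const_one[of "x $ i"] arg_cong[of x _ "\<lambda>z. z \<bullet> 1"] by metis
    then have "x = 0" using that(2) by (simp add: vec_eq_iff)
    then show False using that by simp
  qed
  define S where "S = {x :: real^'n. norm x = 1 \<and> x \<bullet> 1 = 0}"
  have S: "x /\<^sub>R norm x \<in> S" if "x \<noteq> 0" "x \<bullet> 1 = 0" for x
    using that by (simp add: S_def)
  \<comment> \<open>The difference of two basis vectors witnesses that both the admissible set and
    its normalised part \<open>S\<close> are nonempty.\<close>
  have z: "axis i0 1 - axis j0 1 \<noteq> (0::real^'n)" "(axis i0 1 - axis j0 1 :: real^'n) \<bullet> 1 = 0"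
    using assms(3) by (auto simp: axis_eq_axis inner_diff_left inner_axis')
  have "S \<noteq> {}" using S[OF z] by blast
  moreover have "compact S"
  proof -
    have "S = sphere 0 1 \<inter> {x. x \<bullet> 1 = 0}" by (auto simp: S_def)
    moreover have "closed {x :: real^'n. x \<bullet> 1 = 0}"
      by (intro closed_Collect_eq continuous_intros)
    ultimately show ?thesis by (simp add: compact_Int_closed)
  qed
  moreover have "continuous_on S q" unfolding q by (intro continuous_intros)
  ultimately obtain x0 where x0: "x0 \<in> S" "\<And>x. x \<in> S \<Longrightarrow> q x0 \<le> q x"
    using continuous_attains_inf[of S q] by metis
  have "0 < q x0" using x0(1) by (intro q_pos) (auto simp: S_def)
  also have "q x0 \<le> lambda2 (laplacian M)"
    unfolding lambda2_def
  proof (rule cINF_greatest)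
    show "{x :: real^'n. x \<noteq> 0 \<and> x \<bullet> 1 = 0} \<noteq> {}" using z by blast
    fix x :: "real^'n" assume "x \<in> {x. x \<noteq> 0 \<and> x \<bullet> 1 = 0}"
    then have x: "x \<noteq> 0" "x \<bullet> 1 = 0" by auto
    have "q x0 \<le> q (x /\<^sub>R norm x)" by (intro x0 S x)
    also have "\<dots> = x \<bullet> (laplacian M *v x) / (x \<bullet> x)"
      by (simp add: q_def matrix_vector_mult_scaleR power2_norm_eq_inner[symmetric] power2_eq_square field_simps)
    finally show "q x0 \<le> x \<bullet> (laplacian M *v x) / (x \<bullet> x)" .
  qed
  finally show ?thesis .
qed

text \<open>With \<open>r\<close> the norm of the centered vector, Cauchy-Schwarz bounds the left
  side by \<open>2 * dmax * sqrt N * r\<close>, while the sum over edges is at least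
  \<open>sqrt (2 * \<lambda>\<^sub>2) * r\<close>. The threshold for \<open>dbar\<close> is the
  quotient of these two constants.\<close>

lemma disturbance_le_sliding_term:
  fixes A :: "real^'n^'n" and v D :: "'n \<Rightarrow> real"
  assumes A: "undirected_adjacency A"
    and lam: "0 < lambda2 (laplacian (\<chi> i j. (A $ i $ j)\<^sup>2))"
    and D: "\<And>i. \<bar>D i\<bar> \<le> dmax"
    and dbar: "2 * dmax * sqrt (real CARD('n)) / (sqrt 2 * sqrt (lambda2 (laplacian (\<chi> i j. (A $ i $ j)\<^sup>2)))) \<le> dbar"
  shows "2 * (\<Sum>i\<in>UNIV. centered v i * D i)
    \<le> dbar * (\<Sum>i\<in>UNIV. \<Sum>j\<in>UNIV. A $ i $ j * \<bar>v i - v j\<bar>)"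
proof -
  let ?l = "lambda2 (laplacian (\<chi> i j. (A $ i $ j)\<^sup>2))"
  have A': "0 \<le> A $ i $ j" "A $ i $ j = A $ j $ i" for i j
    using A by (auto simp: undirected_adjacency_def)
  \<comment> \<open>Any node serves here; \<open>undefined\<close> names one.\<close>
  have dmax: "0 \<le> dmax" using D[of undefined] by linarith
  define r where "r = sqrt (\<Sum>i\<in>UNIV. (centered v i)\<^sup>2)"
  have "(\<Sum>i\<in>UNIV. \<bar>centered v i\<bar>) \<le> sqrt (real CARD('n)) * r"
  proof -
    have "(\<Sum>i\<in>UNIV. \<bar>centered v i\<bar>)\<^sup>2 \<le> (\<Sum>i\<in>UNIV. \<bar>centered v i\<bar>\<^sup>2) * real CARD('n)"
      by (rule sum_squared_le_sum_of_squares)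
    then have "sqrt ((\<Sum>i\<in>UNIV. \<bar>centered v i\<bar>)\<^sup>2) \<le> sqrt (real CARD('n) * (\<Sum>i\<in>UNIV. (centered v i)\<^sup>2))"
      by (intro real_sqrt_le_mono) (simp add: mult.commute)
    then show ?thesis by (simp add: r_def real_sqrt_mult sum_nonneg)
  qed
  then have "2 * dmax * (\<Sum>i\<in>UNIV. \<bar>centered v i\<bar>) \<le> 2 * dmax * (sqrt (real CARD('n)) * r)"
    using dmax by (intro mult_left_mono) auto
  moreover have "(\<Sum>i\<in>UNIV. centered v i * D i) \<le> dmax * (\<Sum>i\<in>UNIV. \<bar>centered v i\<bar>)"
    unfolding sum_distrib_left
  proof (rule sum_mono)
    fix i
    have "centered v i * D i \<le> \<bar>centered v i\<bar> * \<bar>D i\<bar>" by (metis abs_ge_self abs_mult)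
    also have "\<dots> \<le> \<bar>centered v i\<bar> * dmax" by (intro mult_left_mono D) auto
    finally show "centered v i * D i \<le> dmax * \<bar>centered v i\<bar>" by (simp add: mult.commute)
  qed
  moreover have "2 * dmax * sqrt (real CARD('n)) \<le> dbar * (sqrt 2 * sqrt ?l)"
    using dbar lam by (simp add: pos_divide_le_eq)
  then have "2 * dmax * sqrt (real CARD('n)) * r \<le> dbar * (sqrt 2 * sqrt ?l) * r"
    by (intro mult_right_mono) (auto simp: r_def sum_nonneg)
  moreover have "sqrt 2 * sqrt ?l * r \<le> (\<Sum>i\<in>UNIV. \<Sum>j\<in>UNIV. A $ i $ j * \<bar>v i - v j\<bar>)"
  proof -
    have "undirected_adjacency (\<chi> i j. (A $ i $ j)\<^sup>2)"
      using A' by (simp add: undirected_adjacency_def)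
    from lambda2_laplacian_le[OF this, of v]
    have "2 * ?l * (\<Sum>i\<in>UNIV. (centered v i)\<^sup>2)
        \<le> (\<Sum>i\<in>UNIV. \<Sum>j\<in>UNIV. (A $ i $ j * \<bar>v i - v j\<bar>)\<^sup>2)"
      by (simp add: power_mult_distrib)
    \<comment> \<open>The l2 norm over all ordered pairs is at most the l1 norm. The weights stand
      inside the square, so the form in question is that of the squared weights.\<close>
    then have "sqrt (2 * ?l * (\<Sum>i\<in>UNIV. (centered v i)\<^sup>2))
        \<le> L2_set (\<lambda>(i, j). A $ i $ j * \<bar>v i - v j\<bar>) (UNIV \<times> UNIV)"
      unfolding L2_set_def by (intro real_sqrt_le_mono) (simp add: sum.cartesian_product case_prod_unfold)
    also have "\<dots> \<le> (\<Sum>(i, j)\<in>UNIV \<times> UNIV. A $ i $ j * \<bar>v i - v j\<bar>)"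
      by (rule L2_set_le_sum) (auto intro!: mult_nonneg_nonneg A'(1))
    finally show ?thesis by (simp add: r_def real_sqrt_mult sum.cartesian_product)
  qed
  moreover have "0 \<le> dbar"
  proof -
    have "0 \<le> 2 * dmax * sqrt (real CARD('n)) / (sqrt 2 * sqrt ?l)" using dmax lam by simp
    then show ?thesis using dbar by linarith
  qed
  ultimately have "2 * (\<Sum>i\<in>UNIV. centered v i * D i) \<le> dbar * (sqrt 2 * sqrt ?l * r)"
    by (simp add: mult_ac)
  also have "\<dots> \<le> dbar * (\<Sum>i\<in>UNIV. \<Sum>j\<in>UNIV. A $ i $ j * \<bar>v i - v j\<bar>)"
    by (intro mult_left_mono) fact+
  finally show ?thesis .
qed

subsection \<open>A differential inequality with finite extinction time\<close>

text \<open>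
  \<open>V\<close> need not be differentiable, so it is compared with the \<open>C\<^sup>1\<close> function
  \<open>U t = V b + C * (integral of V powr \<alpha> over {t..b})\<close>, which lies below \<open>V\<close>, agrees with it
  at \<open>b\<close> and satisfies \<open>U' = - C * V powr \<alpha> \<le> - C * U powr \<alpha>\<close>.
\<close>

lemma finite_time_extinction:
  fixes V :: "real \<Rightarrow> real"
  assumes \<alpha>: "0 < \<alpha>" "\<alpha> < 1" and C: "0 < C"
    and cont: "continuous_on {0<..} V" and nonneg: "\<And>t. 0 < t \<Longrightarrow> 0 \<le> V t"
    and lim: "(V \<longlongrightarrow> V0) (at_right 0)"
    and diss: "\<And>a b. 0 < a \<Longrightarrow> a \<le> b \<Longrightarrow> V b - V a \<le> - C * integral {a..b} (\<lambda>t. V t powr \<alpha>)"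
    and b: "0 < b" "V0 powr (1 - \<alpha>) / (C * (1 - \<alpha>)) \<le> b"
  shows "V b = 0"
proof (rule ccontr)
  assume "V b \<noteq> 0"
  then have Vb: "0 < V b" using nonneg[OF b(1)] by linarith
  have step: "V b powr (1 - \<alpha>) + C * (1 - \<alpha>) * (b - a) \<le> V a powr (1 - \<alpha>)" if a: "0 < a" "a < b" for a
  proof -
    have c: "continuous_on {a..b} (\<lambda>t. V t powr \<alpha>)"
      using a nonneg \<alpha> by (intro continuous_on_powr' continuous_intros continuous_on_subset[OF cont]) auto
    define J where "J t = integral {a..t} (\<lambda>t. V t powr \<alpha>)" for t
    define U where "U t = V b + C * (J b - J t)" for t
    have J_split: "J b - J t = integral {t..b} (\<lambda>t. V t powr \<alpha>)" if "a \<le> t" "t \<le> b" for t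
      using Henstock_Kurzweil_Integration.integral_combine[OF that integrable_continuous_real[OF c]] unfolding J_def by linarith
    have U_le: "U t \<le> V t" if "a \<le> t" "t \<le> b" for t
      using diss[of t b] that a J_split[OF that] by (simp add: U_def)
    \<comment> \<open>This is what the assumption \<open>V b \<noteq> 0\<close> is for:
      \<open>U\<close> stays above \<open>V b > 0\<close>, so \<open>U powr (1 - \<alpha>)\<close>
      is differentiable on the whole interval.\<close>
    have U_pos: "0 < U t" if "a \<le> t" "t \<le> b" for t
    proof -
      have "0 \<le> integral {t..b} (\<lambda>t. V t powr \<alpha>)" by (rule integral_nonneg) (use that c in \<open>auto intro!: integrable_continuous_real elim: continuous_on_subset\<close>)
      then show ?thesis using Vb C J_split[OF that] by (simp add: U_def add_pos_nonneg)
    qed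
    have J': "(J has_real_derivative V t powr \<alpha>) (at t within {a..b})" if "t \<in> {a..b}" for t
      unfolding J_def by (rule integral_has_real_derivative[OF c that])
    have U': "((\<lambda>t. U t powr (1 - \<alpha>) + C * (1 - \<alpha>) * t) has_real_derivative
        (1 - \<alpha>) * U t powr (- \<alpha>) * (- C * V t powr \<alpha>) + C * (1 - \<alpha>)) (at t within {a..b})"
      if "t \<in> {a..b}" for t
    proof -
      have "(U has_real_derivative (- C * V t powr \<alpha>)) (at t within {a..b})"
        unfolding U_def by (auto intro!: derivative_eq_intros J'[OF that])
      then have "((\<lambda>t. U t powr (1 - \<alpha>)) has_real_derivative
          (1 - \<alpha>) * U t powr (- \<alpha>) * (- C * V t powr \<alpha>)) (at t within {a..b})"
        using has_real_derivative_powr[of "U t" "1 - \<alpha>"] U_pos[of t] that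
        by (intro DERIV_chain2[where g = U and f = "\<lambda>z. z powr (1 - \<alpha>)"]) auto
      then show ?thesis by (rule DERIV_add) (auto intro!: derivative_eq_intros)
    qed
    have "U b powr (1 - \<alpha>) + C * (1 - \<alpha>) * b \<le> U a powr (1 - \<alpha>) + C * (1 - \<alpha>) * a"
    proof (rule DERIV_nonpos_imp_decreasing_open[OF less_imp_le[OF a(2)], where f = "\<lambda>t. U t powr (1 - \<alpha>) + C * (1 - \<alpha>) * t"])
      show "continuous_on {a..b} (\<lambda>t. U t powr (1 - \<alpha>) + C * (1 - \<alpha>) * t)"
        using U' by (intro DERIV_continuous_on) auto
      fix t assume t: "a < t" "t < b"
      \<comment> \<open>Since \<open>U \<le> V\<close>, the factor
        \<open>U powr (- \<alpha>) * V powr \<alpha>\<close> in the derivative is at least 1, which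
        gives the constant rate \<open>C * (1 - \<alpha>)\<close>.\<close>
      have "1 = U t powr (- \<alpha>) * U t powr \<alpha>" using U_pos[of t] t by (simp flip: powr_add)
      also have "\<dots> \<le> U t powr (- \<alpha>) * V t powr \<alpha>"
        using U_le[of t] U_pos[of t] t \<alpha> by (intro mult_left_mono powr_mono2) auto
      finally have "C * (1 - \<alpha>) * 1 \<le> C * (1 - \<alpha>) * (U t powr (- \<alpha>) * V t powr \<alpha>)"
        using C \<alpha> by (intro mult_left_mono) auto
      then have "(1 - \<alpha>) * U t powr (- \<alpha>) * (- C * V t powr \<alpha>) + C * (1 - \<alpha>) \<le> 0"
        by (simp add: algebra_simps)
      moreover have "at t within {a..b} = at t" using t by (intro at_within_Icc_at) auto
      ultimately show "\<exists>D. ((\<lambda>t. U t powr (1 - \<alpha>) + C * (1 - \<alpha>) * t) has_real_derivative D) (at t) \<and> D \<le> 0"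
        using U'[of t] t by auto
    qed
    moreover have "U a powr (1 - \<alpha>) \<le> V a powr (1 - \<alpha>)"
      using U_le[of a] U_pos[of a] a \<alpha> by (intro powr_mono2) auto
    moreover have "U b = V b" by (simp add: U_def)
    ultimately show ?thesis by (simp add: algebra_simps)
  qed
  \<comment> \<open>The estimate \<open>step\<close> holds only for positive \<open>a\<close>; the
    initial energy enters as a limit.\<close>
  have "\<forall>\<^sub>F a in at_right 0. 0 < a \<and> a < b"
    using b(1) by (auto simp: eventually_at_right_field)
  then have ev: "\<forall>\<^sub>F a in at_right 0. V b powr (1 - \<alpha>) + C * (1 - \<alpha>) * (b - a) \<le> V a powr (1 - \<alpha>)"
    by eventually_elim (rule step, auto)
  have "\<forall>\<^sub>F a in at_right 0. 0 \<le> V a"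
    using \<open>\<forall>\<^sub>F a in at_right 0. 0 < a \<and> a < b\<close> by eventually_elim (auto intro: nonneg)
  then have "((\<lambda>a. V a powr (1 - \<alpha>)) \<longlongrightarrow> V0 powr (1 - \<alpha>)) (at_right 0)"
    using \<alpha> by (intro tendsto_powr'[OF lim tendsto_const]) auto
  moreover have "((\<lambda>a. V b powr (1 - \<alpha>) + C * (1 - \<alpha>) * (b - a)) \<longlongrightarrow>
      V b powr (1 - \<alpha>) + C * (1 - \<alpha>) * (b - 0)) (at_right 0)"
    by (intro tendsto_intros)
  ultimately have "V b powr (1 - \<alpha>) + C * (1 - \<alpha>) * (b - 0) \<le> V0 powr (1 - \<alpha>)"
    using ev by (intro tendsto_le[of "at_right 0"]) auto
  moreover have "V0 powr (1 - \<alpha>) \<le> C * (1 - \<alpha>) * b"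
    using b(2) C \<alpha> by (simp add: pos_divide_le_eq mult.commute)
  \<comment> \<open>Strictness here lets \<open>b\<close> equal the extinction bound itself, so that
    consensus is reached at that time and not merely after it.\<close>
  moreover have "0 < V b powr (1 - \<alpha>)" using Vb by simp
  ultimately show False by simp
qed

subsection \<open>Absolutely continuous functions and energy identities\<close>

text \<open>A continuous factor is bounded on a compact set. The function \<open>f\<close> is
  arbitrary off \<open>R\<close>, so measurability is available only after multiplication by the
  indicator.\<close>

lemma set_integrable_continuous_mult:
  fixes f g :: "'a::euclidean_space \<Rightarrow> real"
  assumes "compact R" "continuous_on R f" "set_integrable lborel R g"
  shows "set_integrable lborel R (\<lambda>x. f x * g x)"
proof -
  obtain B where B: "\<And>x. x \<in> R \<Longrightarrow> \<bar>f x\<bar> \<le> B"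
    using compact_imp_bounded[OF compact_continuous_image[OF assms(2,1)]]
    unfolding bounded_iff by auto
  have "R \<in> sets borel" using assms(1) by (rule borel_compact)
  then have [measurable]: "(\<lambda>x. indicator R x *\<^sub>R f x) \<in> borel_measurable borel"
    using assms(2) by (rule borel_measurable_continuous_on_indicator)
  have int: "integrable lborel (\<lambda>x. indicator R x *\<^sub>R g x)"
    using assms(3) by (simp add: set_integrable_def)
  then have [measurable]: "(\<lambda>x. indicator R x *\<^sub>R g x) \<in> borel_measurable borel"
    by (auto dest: borel_measurable_integrable)
  have "integrable lborel (\<lambda>x. (indicator R x *\<^sub>R f x) * (indicator R x *\<^sub>R g x))"
  proof (rule Bochner_Integration.integrable_bound)
    show "integrable lborel (\<lambda>x. B * (indicator R x *\<^sub>R g x))" using int by simp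
    show "AE x in lborel. norm ((indicator R x *\<^sub>R f x) * (indicator R x *\<^sub>R g x))
        \<le> norm (B * (indicator R x *\<^sub>R g x))"
    proof (intro AE_I2)
      fix x
      show "norm ((indicator R x *\<^sub>R f x) * (indicator R x *\<^sub>R g x))
        \<le> norm (B * (indicator R x *\<^sub>R g x))"
        using B[of x] by (auto simp: indicator_def abs_mult intro!: mult_right_mono)
    qed
  qed measurable
  then show ?thesis
    unfolding set_integrable_def by (rule back_subst[where P = "integrable lborel"]) (auto simp: indicator_def)
qed

lemma ac_derivativeD:
  assumes "ac_derivative g g' S" "a \<le> b" "{a..b} \<subseteq> S"
  shows "set_integrable lborel {a..b} g'" "(LINT s:{a..b}|lborel. g' s) = g b - g a"
  using assms by (auto simp: ac_derivative_def)

lemma ac_derivative_subset: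
  "ac_derivative g g' S \<Longrightarrow> T \<subseteq> S \<Longrightarrow> ac_derivative g g' T"
  unfolding ac_derivative_def by blast

lemma ac_derivative_diff:
  assumes "ac_derivative f f' S" "ac_derivative g g' S"
  shows "ac_derivative (\<lambda>t. f t - g t) (\<lambda>t. f' t - g' t) S"
  unfolding ac_derivative_def
proof (intro allI impI)
  fix a b assume "a \<le> b \<and> {a..b} \<subseteq> S"
  then have ab: "a \<le> b" "{a..b} \<subseteq> S" by auto
  note f = ac_derivativeD[OF assms(1) ab] and g = ac_derivativeD[OF assms(2) ab]
  show "set_integrable lborel {a..b} (\<lambda>t. f' t - g' t) \<and>
      f b - g b - (f a - g a) = (LINT t:{a..b}|lborel. f' t - g' t)"
    using set_integral_diff[OF f(1) g(1)] f(2) g(2) by simp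
qed

lemma ac_derivative_continuous_on:
  assumes "ac_derivative g g' {a..b}"
  shows "continuous_on {a..b} g"
proof (cases "a \<le> b")
  case True
  have int: "g' integrable_on {a..b}"
    using ac_derivativeD(1)[OF assms True] by (simp add: set_borel_integral_eq_integral)
  have eq: "g a + integral {a..t} g' = g t" if "t \<in> {a..b}" for t
    using ac_derivativeD[OF assms, of a t] that by (simp add: set_borel_integral_eq_integral)
  have "continuous_on {a..b} (\<lambda>t. g a + integral {a..t} g')"
    by (intro continuous_intros indefinite_integral_continuous_1 int)
  then show ?thesis by (rule continuous_on_eq) (rule eq)
qed auto

text \<open>Both sides are the integral of \<open>f' s * g' t\<close> over the triangle \<open>a \<le> s \<le> t \<le> b\<close>.\<close>

lemma ac_derivative_triangle:
  fixes f g :: "real \<Rightarrow> real"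
  assumes f: "ac_derivative f f' {a..b}" and g: "ac_derivative g g' {a..b}" and "a \<le> b"
  shows "(LINT t:{a..b}|lborel. (f t - f a) * g' t) = (LINT s:{a..b}|lborel. (g b - g s) * f' s)"
proof -
  define F where "F s = indicator {a..b} s *\<^sub>R f' s" for s
  define G where "G s = indicator {a..b} s *\<^sub>R g' s" for s
  have iF: "integrable lborel F" and iG: "integrable lborel G"
    using ac_derivativeD(1)[OF f \<open>a \<le> b\<close>] ac_derivativeD(1)[OF g \<open>a \<le> b\<close>]
    unfolding F_def G_def set_integrable_def by auto
  have [measurable]: "F \<in> borel_measurable borel" "G \<in> borel_measurable borel"
    using iF iG by (auto dest: borel_measurable_integrable)
  have iFG: "integrable (lborel \<Otimes>\<^sub>M lborel) (\<lambda>(s, t). F s * G t)"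
  proof (rule lborel_pair.Fubini_integrable)
    show "integrable lborel (\<lambda>x. LINT y|lborel. norm (case (x, y) of (s, t) \<Rightarrow> F s * G t))"
      using iF by (simp add: abs_mult)
    show "AE x in lborel. integrable lborel (\<lambda>y. case (x, y) of (s, t) \<Rightarrow> F s * G t)"
      using iG by simp
  qed simp
  define H where "H s t = (if s \<le> t then F s * G t else 0)" for s t
  have "integrable (lborel \<Otimes>\<^sub>M lborel) (\<lambda>(s, t). H s t)"
  proof (rule Bochner_Integration.integrable_bound[OF iFG])
    show "(\<lambda>(s, t). H s t) \<in> borel_measurable (lborel \<Otimes>\<^sub>M lborel)"
      unfolding H_def by measurable
  qed (auto simp: H_def)
  then have "(LINT t|lborel. LINT s|lborel. H s t) = (LINT s|lborel. LINT t|lborel. H s t)"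
    by (rule lborel_pair.Fubini_integral)
  moreover have "(LINT s|lborel. H s t) = indicator {a..b} t *\<^sub>R ((f t - f a) * g' t)" for t
  proof (cases "t \<in> {a..b}")
    case True
    have "(LINT s|lborel. H s t) = (LINT s|lborel. (indicator {a..t} s *\<^sub>R f' s) * g' t)"
      using True by (intro Bochner_Integration.integral_cong) (auto simp: H_def F_def G_def indicator_def)
    also have "\<dots> = (LINT s:{a..t}|lborel. f' s) * g' t"
      by (simp add: set_lebesgue_integral_def)
    finally show ?thesis using True ac_derivativeD(2)[OF f, of a t] by simp
  next
    case False
    then have "H s t = 0" for s by (auto simp: H_def G_def)
    then show ?thesis using False by simp
  qed
  moreover have "(LINT t|lborel. H s t) = indicator {a..b} s *\<^sub>R ((g b - g s) * f' s)" for s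
  proof (cases "s \<in> {a..b}")
    case True
    have "(LINT t|lborel. H s t) = (LINT t|lborel. f' s * (indicator {s..b} t *\<^sub>R g' t))"
      using True by (intro Bochner_Integration.integral_cong) (auto simp: H_def F_def G_def indicator_def)
    also have "\<dots> = f' s * (LINT t:{s..b}|lborel. g' t)"
      by (simp add: set_lebesgue_integral_def)
    finally show ?thesis using True ac_derivativeD(2)[OF g, of s b] by simp
  next
    case False
    then have "H s t = 0" for t by (auto simp: H_def F_def)
    then show ?thesis using False by simp
  qed
  ultimately show ?thesis by (simp add: set_lebesgue_integral_def)
qed

text \<open>The derivatives exist only almost everywhere and need not be bounded, so the formula is
  read off from the triangle identity: both sides are expanded, and the mixed terms
  \<open>f a * g b\<close> cancel.\<close>

lemma ac_derivative_by_parts: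
  fixes f g :: "real \<Rightarrow> real"
  assumes f: "ac_derivative f f' {a..b}" and g: "ac_derivative g g' {a..b}" and "a \<le> b"
  shows "(LINT t:{a..b}|lborel. f t * g' t) + (LINT t:{a..b}|lborel. g t * f' t) = f b * g b - f a * g a"
proof -
  note f' = ac_derivativeD[OF f \<open>a \<le> b\<close> order_refl] and g' = ac_derivativeD[OF g \<open>a \<le> b\<close> order_refl]
  have i: "set_integrable lborel {a..b} (\<lambda>t. f t * g' t)" "set_integrable lborel {a..b} (\<lambda>t. g t * f' t)"
    using f' g' by (auto intro!: set_integrable_continuous_mult ac_derivative_continuous_on[OF f] ac_derivative_continuous_on[OF g])
  have "(LINT t:{a..b}|lborel. (f t - f a) * g' t) = (LINT t:{a..b}|lborel. f t * g' t) - f a * (g b - g a)"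
    using i(1) g' by (simp add: left_diff_distrib set_integral_diff)
  moreover have "(LINT t:{a..b}|lborel. (g b - g t) * f' t) = g b * (f b - f a) - (LINT t:{a..b}|lborel. g t * f' t)"
    using i(2) f' by (simp add: left_diff_distrib set_integral_diff)
  ultimately show ?thesis using ac_derivative_triangle[OF assms] by (simp add: algebra_simps)
qed

text \<open>Integration by parts against \<open>w'\<close>: the boundary term \<open>w * w'\<close>
  vanishes at both ends, and minus the integral of the square of \<open>w'\<close> remains.\<close>

lemma dirichlet_laplacian_nonpos:
  fixes w :: "real \<Rightarrow> real"
  assumes "ac_derivative w w' {a..b}" "ac_derivative w' w'' {a..b}" "a \<le> b" "w a = 0" "w b = 0"
  shows "(LINT x:{a..b}|lborel. w x * w'' x) \<le> 0"
proof -
  have "0 \<le> (LINT x:{a..b}|lborel. w' x * w' x)"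
    unfolding set_lebesgue_integral_def by (intro Bochner_Integration.integral_nonneg) simp
  then show ?thesis using ac_derivative_by_parts[OF assms(1-3)] assms(4,5) by simp
qed

text \<open>The equation is needed at almost every time, for almost every \<open>x\<close>, whereas
  the product theorem puts \<open>x\<close> outermost. Exchanging the quantifiers requires a
  measurable set, and \<open>P\<close> is arbitrary, so the exchange is made for a measurable null
  set \<open>N\<close> that covers the exceptions.\<close>

lemma AE_lborel_slices:
  fixes P :: "real \<Rightarrow> real \<Rightarrow> bool"
  assumes "AE (x, t) in lborel. P x t"
  shows "AE t in lborel. AE x in lborel. P x t"
proof -
  have "AE z in lborel \<Otimes>\<^sub>M lborel. P (fst z) (snd z)"
    using assms unfolding lborel_prod case_prod_unfold .
  then obtain N where N: "{z \<in> space (lborel \<Otimes>\<^sub>M lborel). \<not> P (fst z) (snd z)} \<subseteq> N"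
      "emeasure (lborel \<Otimes>\<^sub>M lborel) N = 0" "N \<in> sets (lborel \<Otimes>\<^sub>M lborel)"
    by (rule AE_E)
  then have "AE z in lborel \<Otimes>\<^sub>M lborel. z \<notin> N"
    by (intro AE_not_in) (simp add: null_sets_def)
  from lborel_pair.AE_pair[OF this]
  have 1: "AE x in lborel. AE t in lborel. (x, t) \<notin> N" .
  have "{z \<in> space (lborel \<Otimes>\<^sub>M lborel). (fst z, snd z) \<notin> N} = space (lborel \<Otimes>\<^sub>M lborel) - N"
    by auto
  then have "AE t in lborel. AE x in lborel. (x, t) \<notin> N"
    using 1 sets.compl_sets[OF N(3)] by (subst lborel_pair.AE_commute[symmetric]) simp_all
  then show ?thesis
  proof eventually_elim
    fix t assume "AE x in lborel. (x, t) \<notin> N"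
    then show "AE x in lborel. P x t"
      by eventually_elim (use N(1) in \<open>force simp: space_pair_measure\<close>)
  qed
qed

text \<open>On a rectangle of finite measure \<open>L2\<close> is contained in \<open>L1\<close>,
  because \<open>\<bar>v\<bar>\<close> is dominated by \<open>1 + v^2\<close>.\<close>

lemma locally_L2_integrable:
  assumes "locally_L2 L v" "0 < a"
  shows "set_integrable lborel ({0..L} \<times> {a..b}) (\<lambda>(x, t). v x t)"
proof -
  let ?R = "{0..L} \<times> {a..b}"
  have R: "compact ?R" by (intro compact_Times compact_Icc)
  then have [measurable]: "?R \<in> sets borel" by (rule borel_compact)
  have [measurable]: "(\<lambda>(x, t). v x t) \<in> borel_measurable borel"
    using assms by (simp add: locally_L2_def)
  have "set_integrable lborel ?R (\<lambda>_. 1 :: real)"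
    unfolding set_integrable_def using R by (intro borel_integrable_compact) auto
  then have "set_integrable lborel ?R (\<lambda>z. 1 + (\<lambda>(x, t). (v x t)\<^sup>2) z)"
    using assms by (intro set_integral_add(1)) (auto simp: locally_L2_def)
  then show ?thesis
  proof (rule set_integrable_bound)
    show "set_borel_measurable lborel ?R (\<lambda>(x, t). v x t)"
      unfolding set_borel_measurable_def by measurable
    show "AE z in lborel. z \<in> ?R \<longrightarrow> norm (case z of (x, t) \<Rightarrow> v x t) \<le> norm (1 + (case z of (x, t) \<Rightarrow> (v x t)\<^sup>2))"
    proof (intro AE_I2 impI)
      fix z :: "real \<times> real"
      obtain x t where z: "z = (x, t)" by force
      have "0 \<le> (\<bar>v x t\<bar> - 1)\<^sup>2" by simp
      then have "2 * \<bar>v x t\<bar> \<le> 1 + (v x t)\<^sup>2" by (simp add: power2_diff)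
      then show "norm (case z of (x, t) \<Rightarrow> v x t) \<le> norm (1 + (case z of (x, t) \<Rightarrow> (v x t)\<^sup>2))"
        unfolding z by simp
    qed
  qed
qed

lemma lborel_slice_integrable:
  fixes v :: "real \<Rightarrow> real \<Rightarrow> real"
  assumes "set_integrable lborel (S \<times> {a..b}) (\<lambda>(x, t). v x t)"
  shows "AE t in lborel. t \<in> {a..b} \<longrightarrow> set_integrable lborel S (\<lambda>x. v x t)"
proof -
  have "integrable (lborel \<Otimes>\<^sub>M lborel) (\<lambda>(x, t). indicator S x *\<^sub>R indicator {a..b} t *\<^sub>R v x t)"
    using assms unfolding set_integrable_def lborel_prod
    by (rule back_subst[where P = "integrable lborel"]) (auto simp: indicator_def fun_eq_iff)
  from lborel_pair.AE_integrable_snd[OF this]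
  show ?thesis
    by eventually_elim (auto simp: set_integrable_def indicator_def)
qed

text \<open>For almost every fixed \<open>x\<close>, integration by parts in \<open>t\<close> of
  \<open>w\<close> against itself gives the increment of \<open>w^2\<close>; integrating over
  \<open>x\<close> and applying Fubini's theorem gives the claim. Continuity on the closed rectangle
  makes \<open>w\<close> bounded, hence \<open>w * wt\<close> integrable.\<close>

lemma energy_identity:
  fixes w wt :: "real \<Rightarrow> real \<Rightarrow> real"
  assumes "0 \<le> L" "a \<le> b" and cont: "continuous_on ({0..L} \<times> {a..b}) (\<lambda>(x, t). w x t)"
    and wt: "set_integrable lborel ({0..L} \<times> {a..b}) (\<lambda>(x, t). wt x t)"
    and ac: "AE x in lborel. x \<in> {0..L} \<longrightarrow> ac_derivative (\<lambda>t. w x t) (\<lambda>t. wt x t) {a..b}"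
  shows "set_integrable lborel {a..b} (\<lambda>t. LINT x:{0..L}|lborel. w x t * wt x t)"
    and "integral {0..L} (\<lambda>x. (w x b)\<^sup>2) - integral {0..L} (\<lambda>x. (w x a)\<^sup>2)
      = 2 * (LINT t:{a..b}|lborel. LINT x:{0..L}|lborel. w x t * wt x t)"
proof -
  define H where "H x t = indicator {0..L} x *\<^sub>R indicator {a..b} t *\<^sub>R (w x t * wt x t)" for x t
  have "set_integrable lborel ({0..L} \<times> {a..b}) (\<lambda>z. (case z of (x, t) \<Rightarrow> w x t) * (case z of (x, t) \<Rightarrow> wt x t))"
    by (intro set_integrable_continuous_mult cont wt compact_Times compact_Icc)
  then have iH: "integrable (lborel \<Otimes>\<^sub>M lborel) (case_prod H)"
    unfolding set_integrable_def lborel_prod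
    by (rule back_subst[where P = "integrable lborel"]) (auto simp: H_def indicator_def fun_eq_iff)
  have in_t: "(LINT x|lborel. H x t) = indicator {a..b} t *\<^sub>R (LINT x:{0..L}|lborel. w x t * wt x t)" for t
    unfolding H_def set_lebesgue_integral_def by (subst scaleR_left_commute) (rule integral_scaleR_right)
  show "set_integrable lborel {a..b} (\<lambda>t. LINT x:{0..L}|lborel. w x t * wt x t)"
    using lborel_pair.integrable_snd[OF iH] by (simp add: in_t set_integrable_def)
  have int_sq: "integral {0..L} (\<lambda>x. (w x t)\<^sup>2) = (LINT x:{0..L}|lborel. (w x t)\<^sup>2)"
    and sq: "set_integrable lborel {0..L} (\<lambda>x. (w x t)\<^sup>2)" if "t \<in> {a..b}" for t
  proof -
    have "continuous_on {0..L} (\<lambda>x. (w x t)\<^sup>2)"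
      using that by (intro continuous_intros continuous_on_compose2[OF cont, where f = "\<lambda>x. (x, t)", simplified]) auto
    then show i: "set_integrable lborel {0..L} (\<lambda>x. (w x t)\<^sup>2)" by (rule borel_integrable_atLeastAtMost')
    then show "integral {0..L} (\<lambda>x. (w x t)\<^sup>2) = (LINT x:{0..L}|lborel. (w x t)\<^sup>2)"
      by (simp add: set_borel_integral_eq_integral)
  qed
  have "integral {0..L} (\<lambda>x. (w x b)\<^sup>2) - integral {0..L} (\<lambda>x. (w x a)\<^sup>2)
      = (LINT x:{0..L}|lborel. (w x b)\<^sup>2 - (w x a)\<^sup>2)"
    using \<open>a \<le> b\<close> by (simp add: int_sq sq set_integral_diff)
  also have "\<dots> = (LINT x|lborel. 2 * (LINT t|lborel. H x t))"
    unfolding set_lebesgue_integral_def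
  proof (rule integral_cong_AE)
    show "(\<lambda>x. indicator {0..L} x *\<^sub>R ((w x b)\<^sup>2 - (w x a)\<^sup>2)) \<in> borel_measurable lborel"
      using set_integral_diff(1)[OF sq[of b] sq[of a]] \<open>a \<le> b\<close>
      by (auto simp: set_integrable_def dest: borel_measurable_integrable)
    show "(\<lambda>x. 2 * (LINT t|lborel. H x t)) \<in> borel_measurable lborel"
      using lborel_pair.integrable_fst[OF iH] by (auto dest: borel_measurable_integrable)
    from ac show "AE x in lborel. indicator {0..L} x *\<^sub>R ((w x b)\<^sup>2 - (w x a)\<^sup>2) = 2 * (LINT t|lborel. H x t)"
    proof eventually_elim
      fix x assume x: "x \<in> {0..L} \<longrightarrow> ac_derivative (\<lambda>t. w x t) (\<lambda>t. wt x t) {a..b}"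
      show "indicator {0..L} x *\<^sub>R ((w x b)\<^sup>2 - (w x a)\<^sup>2) = 2 * (LINT t|lborel. H x t)"
      proof (cases "x \<in> {0..L}")
        case True
        then have "ac_derivative (\<lambda>t. w x t) (\<lambda>t. wt x t) {a..b}" using x by simp
        from ac_derivative_by_parts[OF this this \<open>a \<le> b\<close>] True show ?thesis
          by (simp add: H_def set_lebesgue_integral_def power2_eq_square)
      next
        case False
        then show ?thesis by (simp add: H_def)
      qed
    qed
  qed
  also have "\<dots> = 2 * (LINT t|lborel. LINT x|lborel. H x t)"
    by (simp add: lborel_pair.Fubini_integral[OF iH])
  finally show "integral {0..L} (\<lambda>x. (w x b)\<^sup>2) - integral {0..L} (\<lambda>x. (w x a)\<^sup>2)
      = 2 * (LINT t:{a..b}|lborel. LINT x:{0..L}|lborel. w x t * wt x t)"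
    by (simp add: in_t set_lebesgue_integral_def)
qed

subsection \<open>Dissipation along the closed loop\<close>

text \<open>The polarised form of \<open>sum_centered_square\<close>. It translates the pairwise
  products that arise from the energies \<open>W i j\<close> into a pairing of the deviations with
  the right-hand sides.\<close>

lemma sum_diff_mult_diff:
  fixes v g :: "'n::finite \<Rightarrow> real"
  shows "(\<Sum>i\<in>UNIV. \<Sum>j\<in>UNIV. (v i - v j) * (g i - g j))
    = 2 * real CARD('n) * (\<Sum>i\<in>UNIV. centered v i * g i)"
proof -
  have "2 * (\<Sum>i\<in>UNIV. g i * (\<Sum>j\<in>UNIV. v i - v j))
      = (\<Sum>i\<in>UNIV. \<Sum>j\<in>UNIV. (g i - g j) * (v i - v j))"
    by (rule sum_antisym_pairing) simp
  then show ?thesis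
    by (simp add: sum_diff_eq_centered sum_distrib_left mult_ac)
qed

text \<open>Everything is frozen at one point \<open>(x, t)\<close>: \<open>c\<close> is the
  nonlocal gain and \<open>\<sigma>\<close> the selected sign values. Symmetry of \<open>A\<close>
  and \<open>c\<close> and antisymmetry of \<open>\<sigma>\<close> allow summation by parts in both
  feedback terms; the sign term then absorbs \<open>D\<close>, and the coupling is left.\<close>

lemma controller_dissipation:
  fixes A :: "real^'n^'n" and v D g :: "'n \<Rightarrow> real" and c \<sigma> :: "'n \<Rightarrow> 'n \<Rightarrow> real"
  assumes A: "undirected_adjacency A"
    and lam: "0 < lambda2 (laplacian (\<chi> i j. (A $ i $ j)\<^sup>2))"
    and D: "\<And>i. \<bar>D i\<bar> \<le> dmax"
    and dbar: "2 * dmax * sqrt (real CARD('n)) / (sqrt 2 * sqrt (lambda2 (laplacian (\<chi> i j. (A $ i $ j)\<^sup>2)))) \<le> dbar"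
    and c: "\<And>i j. c j i = c i j"
    and \<sigma>: "\<And>i j. v i \<noteq> v j \<Longrightarrow> \<sigma> i j = sgn (v i - v j)" "\<And>i j. \<sigma> j i = - \<sigma> i j"
    and g: "\<And>i. g i = - (\<Sum>j\<in>UNIV. A $ i $ j * c i j * (v i - v j)) - dbar * (\<Sum>j\<in>UNIV. A $ i $ j * \<sigma> i j) + D i"
  shows "(\<Sum>i\<in>UNIV. \<Sum>j\<in>UNIV. (v i - v j) * (g i - g j))
    \<le> - real CARD('n) * (\<Sum>i\<in>UNIV. \<Sum>j\<in>UNIV. A $ i $ j * c i j * (v i - v j)\<^sup>2)"
proof -
  have A': "A $ i $ j = A $ j $ i" for i j
    using A by (auto simp: undirected_adjacency_def)
  have "2 * (\<Sum>i\<in>UNIV. centered v i * (\<Sum>j\<in>UNIV. A $ i $ j * c i j * (v i - v j)))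
      = (\<Sum>i\<in>UNIV. \<Sum>j\<in>UNIV. (centered v i - centered v j) * (A $ i $ j * c i j * (v i - v j)))"
    by (rule sum_antisym_pairing) (subst A', simp add: c algebra_simps)
  then have 1: "2 * (\<Sum>i\<in>UNIV. centered v i * (\<Sum>j\<in>UNIV. A $ i $ j * c i j * (v i - v j)))
      = (\<Sum>i\<in>UNIV. \<Sum>j\<in>UNIV. A $ i $ j * c i j * (v i - v j)\<^sup>2)"
    by (simp add: centered_diff power2_eq_square mult_ac)
  have "2 * (\<Sum>i\<in>UNIV. centered v i * (\<Sum>j\<in>UNIV. A $ i $ j * \<sigma> i j))
      = (\<Sum>i\<in>UNIV. \<Sum>j\<in>UNIV. (centered v i - centered v j) * (A $ i $ j * \<sigma> i j))"
    by (rule sum_antisym_pairing) (subst A', subst \<sigma>(2), simp)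
  also have "\<dots> = (\<Sum>i\<in>UNIV. \<Sum>j\<in>UNIV. A $ i $ j * \<bar>v i - v j\<bar>)"
  proof (intro sum.cong refl)
    fix i j
    \<comment> \<open>Where \<open>v i = v j\<close> the factor \<open>v i - v j\<close> is 0, so
      every admissible sign value yields the same product.\<close>
    have "(v i - v j) * \<sigma> i j = \<bar>v i - v j\<bar>"
      using \<sigma>(1)[of i j] by (cases "v i = v j") (auto simp: sgn_if)
    then show "(centered v i - centered v j) * (A $ i $ j * \<sigma> i j) = A $ i $ j * \<bar>v i - v j\<bar>"
      by (simp add: centered_diff)
  qed
  finally have 2: "2 * (\<Sum>i\<in>UNIV. centered v i * (\<Sum>j\<in>UNIV. A $ i $ j * \<sigma> i j))
      = (\<Sum>i\<in>UNIV. \<Sum>j\<in>UNIV. A $ i $ j * \<bar>v i - v j\<bar>)" .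
  have "2 * (\<Sum>i\<in>UNIV. centered v i * g i)
      = - (2 * (\<Sum>i\<in>UNIV. centered v i * (\<Sum>j\<in>UNIV. A $ i $ j * c i j * (v i - v j))))
        - dbar * (2 * (\<Sum>i\<in>UNIV. centered v i * (\<Sum>j\<in>UNIV. A $ i $ j * \<sigma> i j)))
        + 2 * (\<Sum>i\<in>UNIV. centered v i * D i)"
  proof -
    have "centered v i * g i = - (centered v i * (\<Sum>j\<in>UNIV. A $ i $ j * c i j * (v i - v j)))
        - dbar * (centered v i * (\<Sum>j\<in>UNIV. A $ i $ j * \<sigma> i j)) + centered v i * D i" for i
      unfolding g by (simp only: ring_distribs) (simp add: mult_ac)
    then have "(\<Sum>i\<in>UNIV. centered v i * g i) = - (\<Sum>i\<in>UNIV. centered v i * (\<Sum>j\<in>UNIV. A $ i $ j * c i j * (v i - v j)))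
        - dbar * (\<Sum>i\<in>UNIV. centered v i * (\<Sum>j\<in>UNIV. A $ i $ j * \<sigma> i j)) + (\<Sum>i\<in>UNIV. centered v i * D i)"
      by (simp only: sum.distrib sum_subtractf sum_negf sum_distrib_left)
    then show ?thesis by simp
  qed
  also have "\<dots> \<le> - (\<Sum>i\<in>UNIV. \<Sum>j\<in>UNIV. A $ i $ j * c i j * (v i - v j)\<^sup>2)"
    unfolding 1 2 using disturbance_le_sliding_term[where v = v and D = D, OF A lam D dbar] by linarith
  finally have "real CARD('n) * (2 * (\<Sum>i\<in>UNIV. centered v i * g i))
      \<le> real CARD('n) * - (\<Sum>i\<in>UNIV. \<Sum>j\<in>UNIV. A $ i $ j * c i j * (v i - v j)\<^sup>2)"
    by (intro mult_left_mono) auto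
  then show ?thesis by (subst sum_diff_mult_diff) (simp add: mult_ac)
qed

lemma set_integral_sum:
  fixes f :: "'i \<Rightarrow> 'a \<Rightarrow> real"
  assumes "\<And>i. i \<in> I \<Longrightarrow> set_integrable M S (f i)"
  shows "set_integrable M S (\<lambda>x. \<Sum>i\<in>I. f i x)"
    and "(LINT x:S|M. (\<Sum>i\<in>I. f i x)) = (\<Sum>i\<in>I. LINT x:S|M. f i x)"
  using assms unfolding set_integrable_def set_lebesgue_integral_def
  by (auto simp: sum_distrib_left Bochner_Integration.integral_sum)

text \<open>The feedback is estimated at each \<open>x\<close>, but the diffusion has a sign only
  after integration over \<open>x\<close>. The two contributions are therefore kept apart until the
  pointwise inequality has been integrated.\<close>

lemma dissipation_slice:
  fixes A :: "real^'n^'n" and v p vx vxx D :: "'n \<Rightarrow> real \<Rightarrow> real"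
    and \<sigma> :: "'n \<Rightarrow> 'n \<Rightarrow> real \<Rightarrow> real" and W :: "'n \<Rightarrow> 'n \<Rightarrow> real"
  assumes L: "0 \<le> L" and k: "0 \<le> k" and A: "undirected_adjacency A"
    and lam: "0 < lambda2 (laplacian (\<chi> i j. (A $ i $ j)\<^sup>2))"
    and D: "\<And>i x. x \<in> {0..L} \<Longrightarrow> \<bar>D i x\<bar> \<le> dmax"
    and dbar: "2 * dmax * sqrt (real CARD('n)) / (sqrt 2 * sqrt (lambda2 (laplacian (\<chi> i j. (A $ i $ j)\<^sup>2)))) \<le> dbar"
    and bc: "\<And>i. v i 0 = 0" "\<And>i. v i L = 0"
    and ac: "\<And>i. ac_derivative (v i) (vx i) {0..L}" "\<And>i. ac_derivative (vx i) (vxx i) {0..L}"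
    and p: "\<And>i. set_integrable lborel {0..L} (p i)"
    and \<sigma>: "\<And>i j x. v i x \<noteq> v j x \<Longrightarrow> \<sigma> i j x = sgn (v i x - v j x)" "\<And>i j x. \<sigma> j i x = - \<sigma> i j x"
    and W: "\<And>i j. W i j = integral {0..L} (\<lambda>x. (v i x - v j x)\<^sup>2)"
    and pde: "AE x in lborel. \<forall>i. x \<in> {0..L} \<longrightarrow> p i x = k * vxx i x +
      (- (\<Sum>j\<in>UNIV. A $ i $ j * W i j powr (\<alpha> - 1) * (v i x - v j x)) - dbar * (\<Sum>j\<in>UNIV. A $ i $ j * \<sigma> i j x) + D i x)"
  shows "(\<Sum>i\<in>UNIV. \<Sum>j\<in>UNIV. LINT x:{0..L}|lborel. (v i x - v j x) * (p i x - p j x))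
    \<le> - real CARD('n) * (\<Sum>i\<in>UNIV. \<Sum>j\<in>UNIV. A $ i $ j * W i j powr \<alpha>)"
proof -
  let ?N = "real CARD('n)"
  have cont: "continuous_on {0..L} (\<lambda>x. v i x - v j x)" for i j
    by (intro continuous_intros ac_derivative_continuous_on[OF ac(1)])
  have vxx: "set_integrable lborel {0..L} (vxx i)" for i
    using ac_derivativeD(1)[OF ac(2) L] by simp
  define c where "c i j = W i j powr (\<alpha> - 1)" for i j
  have c: "c j i = c i j" for i j by (simp add: c_def W power2_commute)
  have i1: "set_integrable lborel {0..L} (\<lambda>x. (v i x - v j x) * (p i x - p j x))"
    and i2: "set_integrable lborel {0..L} (\<lambda>x. (v i x - v j x) * (vxx i x - vxx j x))" for i j
    by (intro set_integrable_continuous_mult cont set_integral_diff(1) p vxx compact_Icc)+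
  have sq: "set_integrable lborel {0..L} (\<lambda>x. (v i x - v j x)\<^sup>2)" for i j
    by (intro borel_integrable_atLeastAtMost' continuous_intros cont)
  have i3: "set_integrable lborel {0..L} (\<lambda>x. A $ i $ j * c i j * (v i x - v j x)\<^sup>2)" for i j
    by (intro set_integrable_mult_right sq)
  have W': "W i j = (LINT x:{0..L}|lborel. (v i x - v j x)\<^sup>2)" for i j
    using sq[of i j] by (simp add: W set_borel_integral_eq_integral)
  have W0: "0 \<le> W i j" for i j
    unfolding W by (rule Henstock_Kurzweil_Integration.integral_nonneg) (use sq set_borel_integral_eq_integral in auto)
  have "(\<Sum>i\<in>UNIV. \<Sum>j\<in>UNIV. LINT x:{0..L}|lborel. (v i x - v j x) * (p i x - p j x))
      = (LINT x:{0..L}|lborel. \<Sum>i\<in>UNIV. \<Sum>j\<in>UNIV. (v i x - v j x) * (p i x - p j x))"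
    by (simp add: set_integral_sum i1)
  also have "\<dots> \<le> (LINT x:{0..L}|lborel. k * (\<Sum>i\<in>UNIV. \<Sum>j\<in>UNIV. (v i x - v j x) * (vxx i x - vxx j x))
      - ?N * (\<Sum>i\<in>UNIV. \<Sum>j\<in>UNIV. A $ i $ j * c i j * (v i x - v j x)\<^sup>2))"
  proof (rule set_integral_mono_AE)
    from pde show "AE x \<in> {0..L} in lborel. (\<Sum>i\<in>UNIV. \<Sum>j\<in>UNIV. (v i x - v j x) * (p i x - p j x))
      \<le> k * (\<Sum>i\<in>UNIV. \<Sum>j\<in>UNIV. (v i x - v j x) * (vxx i x - vxx j x))
      - ?N * (\<Sum>i\<in>UNIV. \<Sum>j\<in>UNIV. A $ i $ j * c i j * (v i x - v j x)\<^sup>2)"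
    proof eventually_elim
      fix x assume *: "\<forall>i. x \<in> {0..L} \<longrightarrow> p i x = k * vxx i x +
        (- (\<Sum>j\<in>UNIV. A $ i $ j * W i j powr (\<alpha> - 1) * (v i x - v j x)) - dbar * (\<Sum>j\<in>UNIV. A $ i $ j * \<sigma> i j x) + D i x)"
      show "x \<in> {0..L} \<longrightarrow> (\<Sum>i\<in>UNIV. \<Sum>j\<in>UNIV. (v i x - v j x) * (p i x - p j x))
        \<le> k * (\<Sum>i\<in>UNIV. \<Sum>j\<in>UNIV. (v i x - v j x) * (vxx i x - vxx j x))
        - ?N * (\<Sum>i\<in>UNIV. \<Sum>j\<in>UNIV. A $ i $ j * c i j * (v i x - v j x)\<^sup>2)"
      proof
        assume x: "x \<in> {0..L}"
        define g where "g i = - (\<Sum>j\<in>UNIV. A $ i $ j * c i j * (v i x - v j x)) - dbar * (\<Sum>j\<in>UNIV. A $ i $ j * \<sigma> i j x) + D i x" for i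
        have "p i x = k * vxx i x + g i" for i
          using * x by (simp add: g_def c_def)
        then have "(v i x - v j x) * (p i x - p j x)
            = k * ((v i x - v j x) * (vxx i x - vxx j x)) + (v i x - v j x) * (g i - g j)" for i j
          by (simp add: algebra_simps)
        then have "(\<Sum>i\<in>UNIV. \<Sum>j\<in>UNIV. (v i x - v j x) * (p i x - p j x))
            = k * (\<Sum>i\<in>UNIV. \<Sum>j\<in>UNIV. (v i x - v j x) * (vxx i x - vxx j x))
              + (\<Sum>i\<in>UNIV. \<Sum>j\<in>UNIV. (v i x - v j x) * (g i - g j))"
          by (simp only: sum.distrib sum_distrib_left)
        also have "(\<Sum>i\<in>UNIV. \<Sum>j\<in>UNIV. (v i x - v j x) * (g i - g j))
            \<le> - ?N * (\<Sum>i\<in>UNIV. \<Sum>j\<in>UNIV. A $ i $ j * c i j * (v i x - v j x)\<^sup>2)"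
        proof (rule controller_dissipation[where D = "\<lambda>i. D i x" and \<sigma> = "\<lambda>i j. \<sigma> i j x", OF A lam _ dbar])
          show "\<bar>D i x\<bar> \<le> dmax" for i by (rule D[OF x])
          show "c j i = c i j" for i j by (rule c)
          show "v i x \<noteq> v j x \<Longrightarrow> \<sigma> i j x = sgn (v i x - v j x)" for i j by (rule \<sigma>(1))
          show "\<sigma> j i x = - \<sigma> i j x" for i j by (rule \<sigma>(2))
        qed (rule g_def)
        finally show "(\<Sum>i\<in>UNIV. \<Sum>j\<in>UNIV. (v i x - v j x) * (p i x - p j x))
          \<le> k * (\<Sum>i\<in>UNIV. \<Sum>j\<in>UNIV. (v i x - v j x) * (vxx i x - vxx j x))
          - ?N * (\<Sum>i\<in>UNIV. \<Sum>j\<in>UNIV. A $ i $ j * c i j * (v i x - v j x)\<^sup>2)" by simp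
      qed
    qed
  qed (intro set_integral_diff(1) set_integrable_mult_right set_integral_sum(1) i1 i2 i3)+
  also have "\<dots> = k * (\<Sum>i\<in>UNIV. \<Sum>j\<in>UNIV. LINT x:{0..L}|lborel. (v i x - v j x) * (vxx i x - vxx j x))
      - ?N * (\<Sum>i\<in>UNIV. \<Sum>j\<in>UNIV. A $ i $ j * c i j * W i j)"
  proof -
    have j2: "set_integrable lborel {0..L} (\<lambda>x. k * (\<Sum>i\<in>UNIV. \<Sum>j\<in>UNIV. (v i x - v j x) * (vxx i x - vxx j x)))"
      and j3: "set_integrable lborel {0..L} (\<lambda>x. ?N * (\<Sum>i\<in>UNIV. \<Sum>j\<in>UNIV. A $ i $ j * c i j * (v i x - v j x)\<^sup>2))"
      by (intro set_integrable_mult_right set_integral_sum(1) i2 i3)+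
    show ?thesis
      unfolding set_integral_diff(2)[OF j2 j3] by (simp add: set_integral_sum i2 i3 W')
  qed
  also have "\<dots> \<le> - ?N * (\<Sum>i\<in>UNIV. \<Sum>j\<in>UNIV. A $ i $ j * c i j * W i j)"
  proof -
    have "(LINT x:{0..L}|lborel. (v i x - v j x) * (vxx i x - vxx j x)) \<le> 0" for i j
      by (rule dirichlet_laplacian_nonpos[OF ac_derivative_diff[OF ac(1) ac(1)] ac_derivative_diff[OF ac(2) ac(2)] L])
        (simp_all add: bc)
    then have "k * (\<Sum>i\<in>UNIV. \<Sum>j\<in>UNIV. LINT x:{0..L}|lborel. (v i x - v j x) * (vxx i x - vxx j x)) \<le> 0"
      using k by (intro mult_nonneg_nonpos sum_nonpos) auto
    then show ?thesis by simp
  qed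
  also have "(\<Sum>i\<in>UNIV. \<Sum>j\<in>UNIV. A $ i $ j * c i j * W i j) = (\<Sum>i\<in>UNIV. \<Sum>j\<in>UNIV. A $ i $ j * W i j powr \<alpha>)"
  proof -
    \<comment> \<open>At \<open>W i j = 0\<close> both sides are 0, by the convention
      \<open>0 powr (\<alpha> - 1) = 0\<close>.\<close>
    have "c i j * W i j = W i j powr \<alpha>" for i j
      using W0[of i j] powr_mult_base[of "W i j" "\<alpha> - 1"] by (simp add: c_def mult.commute)
    then show ?thesis by (simp add: mult.assoc)
  qed
  finally show ?thesis .
qed

text \<open>The graph inequality concerns vectors, so it is applied at each \<open>x\<close> and
  then integrated. Subadditivity of the power is used only afterwards, on the sum over all ordered
  pairs.\<close>

lemma coupling_ge_lambda2:
  fixes A :: "real^'n^'n" and v :: "'n \<Rightarrow> real \<Rightarrow> real"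
  assumes \<alpha>: "0 < \<alpha>" "\<alpha> \<le> 1" and A: "undirected_adjacency A"
    and lam: "0 \<le> lambda2 (laplacian (\<chi> i j. (A $ i $ j) powr (1 / \<alpha>)))"
    and cont: "\<And>i. continuous_on {0..L} (v i)"
    and W: "\<And>i j. W i j = integral {0..L} (\<lambda>x. (v i x - v j x)\<^sup>2)"
  shows "(2 * lambda2 (laplacian (\<chi> i j. (A $ i $ j) powr (1 / \<alpha>)))) powr \<alpha>
      * (1 / (2 * real CARD('n)) * (\<Sum>i\<in>UNIV. \<Sum>j\<in>UNIV. W i j)) powr \<alpha>
    \<le> (\<Sum>i\<in>UNIV. \<Sum>j\<in>UNIV. A $ i $ j * W i j powr \<alpha>)"
proof -
  let ?l = "lambda2 (laplacian (\<chi> i j. (A $ i $ j) powr (1 / \<alpha>)))"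
  let ?V = "1 / (2 * real CARD('n)) * (\<Sum>i\<in>UNIV. \<Sum>j\<in>UNIV. W i j)"
  have A': "0 \<le> A $ i $ j" "A $ i $ j = A $ j $ i" for i j
    using A by (auto simp: undirected_adjacency_def)
  have int: "(\<lambda>x. (v i x - v j x)\<^sup>2) integrable_on {0..L}" for i j
    by (intro integrable_continuous_real continuous_intros cont)
  have W0: "0 \<le> W i j" for i j
    unfolding W by (rule Henstock_Kurzweil_Integration.integral_nonneg[OF int]) simp
  have "undirected_adjacency (\<chi> i j. (A $ i $ j) powr (1 / \<alpha>))"
    using A' by (simp add: undirected_adjacency_def)
  from lambda2_laplacian_le[OF this]
  have pw: "2 * ?l * (1 / (2 * real CARD('n)) * (\<Sum>i\<in>UNIV. \<Sum>j\<in>UNIV. (v i x - v j x)\<^sup>2))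
      \<le> (\<Sum>i\<in>UNIV. \<Sum>j\<in>UNIV. A $ i $ j powr (1 / \<alpha>) * (v i x - v j x)\<^sup>2)" for x
    by (simp add: sum_centered_square)
  have "2 * ?l * ?V = integral {0..L} (\<lambda>x. 2 * ?l * (1 / (2 * real CARD('n)) * (\<Sum>i\<in>UNIV. \<Sum>j\<in>UNIV. (v i x - v j x)\<^sup>2)))"
    by (simp add: Henstock_Kurzweil_Integration.integral_sum int integrable_sum W)
  also have "\<dots> \<le> integral {0..L} (\<lambda>x. \<Sum>i\<in>UNIV. \<Sum>j\<in>UNIV. A $ i $ j powr (1 / \<alpha>) * (v i x - v j x)\<^sup>2)"
    by (rule integral_le[OF _ _ pw]) (intro integrable_continuous_real continuous_intros cont)+
  also have "\<dots> = (\<Sum>i\<in>UNIV. \<Sum>j\<in>UNIV. A $ i $ j powr (1 / \<alpha>) * W i j)"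
    by (simp add: Henstock_Kurzweil_Integration.integral_sum integrable_on_mult_right[OF int] integrable_sum W)
  finally have "(2 * ?l * ?V) powr \<alpha> \<le> (\<Sum>i\<in>UNIV. \<Sum>j\<in>UNIV. A $ i $ j powr (1 / \<alpha>) * W i j) powr \<alpha>"
    using \<alpha> lam by (intro powr_mono2) (auto intro!: mult_nonneg_nonneg divide_nonneg_nonneg sum_nonneg W0)
  also have "\<dots> = (\<Sum>(i, j)\<in>UNIV \<times> UNIV. A $ i $ j powr (1 / \<alpha>) * W i j) powr \<alpha>"
    by (simp add: sum.cartesian_product)
  also have "\<dots> \<le> (\<Sum>p\<in>UNIV \<times> UNIV. (case p of (i, j) \<Rightarrow> A $ i $ j powr (1 / \<alpha>) * W i j) powr \<alpha>)"
    using \<alpha> by (intro powr_sum_le) (auto intro!: mult_nonneg_nonneg W0)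
  also have "\<dots> = (\<Sum>(i, j)\<in>UNIV \<times> UNIV. A $ i $ j * W i j powr \<alpha>)"
    using \<alpha> A' W0 by (intro sum.cong) (auto simp: powr_mult powr_powr)
  also have "\<dots> = (\<Sum>i\<in>UNIV. \<Sum>j\<in>UNIV. A $ i $ j * W i j powr \<alpha>)"
    by (simp add: sum.cartesian_product)
  also have "(2 * ?l * ?V) powr \<alpha> = (2 * ?l) powr \<alpha> * ?V powr \<alpha>"
    by (rule powr_mult)
  finally show ?thesis .
qed

section \<open>Dependence of squared \<open>L2\<close> norms on time\<close>

lemma tendsto_integral_square:
  fixes f :: "real \<Rightarrow> real \<Rightarrow> real" and g :: "real \<Rightarrow> real"
  assumes f: "\<forall>\<^sub>F t in F. continuous_on {a..b} (f t)" and g: "continuous_on {a..b} g"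
    and lim: "((\<lambda>t. integral {a..b} (\<lambda>x. (f t x - g x)\<^sup>2)) \<longlongrightarrow> 0) F"
  shows "((\<lambda>t. integral {a..b} (\<lambda>x. (f t x)\<^sup>2)) \<longlongrightarrow> integral {a..b} (\<lambda>x. (g x)\<^sup>2)) F"
proof (rule tendstoI)
  fix e :: real assume "0 < e"
  define G where "G = integral {a..b} (\<lambda>x. (g x)\<^sup>2)"
  have ig: "(\<lambda>x. (g x)\<^sup>2) integrable_on {a..b}"
    by (intro integrable_continuous_real continuous_intros g)
  have "0 \<le> G" unfolding G_def by (rule Henstock_Kurzweil_Integration.integral_nonneg[OF ig]) simp
  \<comment> \<open>This weight makes \<open>r * G < e / 2\<close>, also when \<open>G = 0\<close>;
    the closeness required of \<open>f t\<close> and \<open>g\<close> below gives the other half of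
    \<open>e\<close>.\<close>
  define r where "r = e / (2 * (G + 1))"
  have r: "0 < r" "r * G < e / 2" using \<open>0 < e\<close> \<open>0 \<le> G\<close> by (auto simp: r_def field_simps)
  have r': "0 < 1 + 1 / r" using r by (simp add: add_pos_pos)
  then have "0 < e / (2 * (1 + 1 / r))" using \<open>0 < e\<close> by (simp only: zero_less_divide_iff zero_less_mult_iff) simp
  from order_tendstoD(2)[OF lim this] f
  show "\<forall>\<^sub>F t in F. dist (integral {a..b} (\<lambda>x. (f t x)\<^sup>2)) (integral {a..b} (\<lambda>x. (g x)\<^sup>2)) < e"
  proof eventually_elim
    fix t assume D: "integral {a..b} (\<lambda>x. (f t x - g x)\<^sup>2) < e / (2 * (1 + 1 / r))" and ft: "continuous_on {a..b} (f t)"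
    define D where "D = integral {a..b} (\<lambda>x. (f t x - g x)\<^sup>2)"
    have i_f: "(\<lambda>x. (f t x)\<^sup>2) integrable_on {a..b}"
      and iD: "(\<lambda>x. (f t x - g x)\<^sup>2) integrable_on {a..b}"
      by (intro integrable_continuous_real continuous_intros g ft)+
    have "\<bar>(f t x)\<^sup>2 - (g x)\<^sup>2\<bar> \<le> (1 + 1 / r) * (f t x - g x)\<^sup>2 + r * (g x)\<^sup>2" for x
    proof -
      define h where "h = f t x - g x"
      \<comment> \<open>Young's inequality with weight \<open>r\<close> for the cross term in
        \<open>(g + h)^2\<close>.\<close>
      have "0 \<le> (\<bar>h\<bar> / sqrt r - sqrt r * \<bar>g x\<bar>)\<^sup>2" by simp
      also have "\<dots> = h\<^sup>2 / r + r * (g x)\<^sup>2 - 2 * (\<bar>h\<bar> * \<bar>g x\<bar>)"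
        using r by (simp add: power2_diff power_divide power_mult_distrib)
      finally have "2 * \<bar>g x * h\<bar> \<le> h\<^sup>2 / r + r * (g x)\<^sup>2" by (simp add: abs_mult mult.commute)
      moreover have "(f t x)\<^sup>2 - (g x)\<^sup>2 = h\<^sup>2 + 2 * (g x * h)"
        by (simp add: h_def power2_eq_square algebra_simps)
      moreover have "(1 + 1 / r) * h\<^sup>2 = h\<^sup>2 + h\<^sup>2 / r" by (simp add: algebra_simps)
      ultimately show ?thesis unfolding h_def[symmetric] using zero_le_power2[of h] by linarith
    qed
    moreover have "(\<lambda>x. (f t x)\<^sup>2 - (g x)\<^sup>2) integrable_on {a..b}"
      and "(\<lambda>x. (1 + 1 / r) * (f t x - g x)\<^sup>2 + r * (g x)\<^sup>2) integrable_on {a..b}"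
      by (intro integrable_diff integrable_add integrable_on_mult_right i_f ig iD)+
    ultimately have "\<bar>integral {a..b} (\<lambda>x. (f t x)\<^sup>2 - (g x)\<^sup>2)\<bar>
        \<le> integral {a..b} (\<lambda>x. (1 + 1 / r) * (f t x - g x)\<^sup>2 + r * (g x)\<^sup>2)"
      using integral_norm_bound_integral[of "\<lambda>x. (f t x)\<^sup>2 - (g x)\<^sup>2" "{a..b}"] by simp
    also have "\<dots> = (1 + 1 / r) * D + r * G"
      by (subst Henstock_Kurzweil_Integration.integral_add)
        (auto intro!: integrable_on_mult_right iD ig simp: D_def G_def)
    also have "(1 + 1 / r) * D < e / 2"
      using D r' by (simp only: D_def pos_less_divide_eq zero_less_mult_iff) (simp add: field_simps)
    finally show "dist (integral {a..b} (\<lambda>x. (f t x)\<^sup>2)) (integral {a..b} (\<lambda>x. (g x)\<^sup>2)) < e"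
      using r by (simp add: dist_real_def Henstock_Kurzweil_Integration.integral_diff[OF i_f ig])
  qed
qed

lemma continuous_on_integral_square:
  fixes w :: "real \<Rightarrow> real \<Rightarrow> real"
  assumes "continuous_on ({0..L} \<times> S) (\<lambda>(x, t). w x t)"
  shows "continuous_on S (\<lambda>t. integral {0..L} (\<lambda>x. (w x t)\<^sup>2))"
proof -
  have "continuous_on (S \<times> cbox 0 L) (\<lambda>(t, x). (w x t)\<^sup>2)"
    unfolding case_prod_unfold
    by (intro continuous_intros continuous_on_compose2[OF assms, where f = "\<lambda>z. (snd z, fst z)", simplified]) auto
  from integral_continuous_on_param[OF this] show ?thesis by simp
qed

section \<open>Energy decay of the closed loop and the terminal time\<close>

theorem theorem3p1:
  fixes A :: "real^'n^'n"
    and \<alpha> L k dbar dmax :: real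
    and y d :: "'n \<Rightarrow> real \<Rightarrow> real \<Rightarrow> real"
    and y0 :: "'n \<Rightarrow> real \<Rightarrow> real"
    and s :: "'n \<Rightarrow> 'n \<Rightarrow> real \<Rightarrow> real \<Rightarrow> real"
  assumes "0 < \<alpha>" "\<alpha> < 1" "0 < L" "0 < k" "0 < dbar"
    and "undirected_adjacency A" "connected_adjacency A"
    and "\<And>i. continuous_on {0..L} (y0 i)" "\<And>i. bounded (y0 i ` {0..L})"
    and "\<And>i. continuous_on ({0..L} \<times> {0..}) (\<lambda>(x, t). d i x t)"
    and "\<And>i x t. x \<in> {0..L} \<Longrightarrow> 0 \<le> t \<Longrightarrow> \<bar>d i x t\<bar> \<le> dmax"
    and "sign_values y s"
    and "strong_solution k L (\<lambda>i x t. controller A \<alpha> dbar L s y i x t + d i x t) y0 y"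
    and "dbar \<ge> 2 * dmax * sqrt (real CARD('n)) / (sqrt 2 * sqrt (lambda2 (laplacian (\<chi> i j. (A $ i $ j)\<^sup>2))))"
  shows "finite_time_consensus L y \<and>
    (\<exists>ts. consensus_time L y ts \<and>
       ts \<le> (integral {0..L} (\<lambda>x. 1 / (2 * real CARD('n)) *
               (\<Sum>i\<in>UNIV. \<Sum>j\<in>UNIV. (y0 i x - y0 j x)\<^sup>2))) powr (1 - \<alpha>)
               / ((2 * lambda2 (laplacian (\<chi> i j. (A $ i $ j) powr (1 / \<alpha>)))) powr \<alpha> * (1 - \<alpha>)))"
proof -
  note \<alpha> = assms(1,2) and L = assms(3) and k = assms(4) and A = assms(6,7) and y0 = assms(8)
    and d = assms(11) and s = assms(12) and sol = assms(13) and dbar = assms(14)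
  define V0 where "V0 = integral {0..L} (\<lambda>x. 1 / (2 * real CARD('n)) *
      (\<Sum>i\<in>UNIV. \<Sum>j\<in>UNIV. (y0 i x - y0 j x)\<^sup>2))"
  define C where "C = (2 * lambda2 (laplacian (\<chi> i j. (A $ i $ j) powr (1 / \<alpha>)))) powr \<alpha>"
  define T where "T = V0 powr (1 - \<alpha>) / (C * (1 - \<alpha>))"
  have "consensus_time L y T"
  proof (cases "\<exists>i j :: 'n. i \<noteq> j")
    \<comment> \<open>For a single node \<open>lambda2\<close> is an infimum over the empty set and
      says nothing about \<open>C\<close>. But then \<open>V0 = 0\<close>, so \<open>T = 0\<close>
      whatever the value of \<open>C\<close>.\<close>
    case False
    then have "i = j" for i j :: 'n by blast
    then have y: "y i = y j" and y0': "y0 i = y0 j" for i j by metis+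
    have diff: "y0 i x - y0 j x = 0" "y i x t - y j x t = 0" for i j x t
      using y[of i j] y0'[of i j] by simp_all
    have "V0 = 0" unfolding V0_def diff by simp
    then show ?thesis unfolding consensus_time_def diff by (simp add: T_def)
  next
    case True
    then obtain i0 j0 :: 'n where ij: "i0 \<noteq> j0" by blast
    have A': "0 \<le> A $ i $ j" "A $ i $ j = A $ j $ i" for i j
      using A by (auto simp: undirected_adjacency_def)
    \<comment> \<open>Entrywise positive powers keep symmetry and the pattern of positive entries,
      so both derived graphs are again connected.\<close>
    have lamE: "0 < lambda2 (laplacian (\<chi> i j. (A $ i $ j)\<^sup>2))"
    proof (rule lambda2_laplacian_pos[OF _ _ ij])
      show "connected_adjacency (\<chi> i j. (A $ i $ j)\<^sup>2)"
        using A(2) A'(1) by (simp add: connected_adjacency_def less_le)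
    qed (use A' in \<open>simp add: undirected_adjacency_def\<close>)
    have lamB: "0 < lambda2 (laplacian (\<chi> i j. (A $ i $ j) powr (1 / \<alpha>)))"
    proof (rule lambda2_laplacian_pos[OF _ _ ij])
      show "connected_adjacency (\<chi> i j. (A $ i $ j) powr (1 / \<alpha>))"
        using A(2) A'(1) by (simp add: connected_adjacency_def less_le)
    qed (use A' in \<open>simp add: undirected_adjacency_def\<close>)
    have C: "0 < C" using lamB by (simp add: C_def)

    have cont: "continuous_on ({0..L} \<times> {0<..}) (\<lambda>(x, t). y i x t)"
      and bc: "0 < t \<Longrightarrow> y i 0 t = 0" "0 < t \<Longrightarrow> y i L t = 0"
      and init: "((\<lambda>t. integral {0..L} (\<lambda>x. (y i x t - y0 i x)\<^sup>2)) \<longlongrightarrow> 0) (at_right 0)" for i t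
      using sol by (auto simp: strong_solution_def)
    define Q where "Q i yt yx yxx \<longleftrightarrow>
        locally_L2 L yt \<and> locally_L2 L yxx \<and>
        (AE x in lborel. x \<in> {0..L} \<longrightarrow> ac_derivative (\<lambda>t. y i x t) (\<lambda>t. yt x t) {0<..}) \<and>
        (AE t in lborel. t > 0 \<longrightarrow>
          ac_derivative (\<lambda>x. y i x t) (\<lambda>x. yx x t) {0..L} \<and>
          ac_derivative (\<lambda>x. yx x t) (\<lambda>x. yxx x t) {0..L}) \<and>
        (AE (x, t) in lborel. x \<in> {0..L} \<and> t > 0 \<longrightarrow>
          yt x t = k * yxx x t + (controller A \<alpha> dbar L s y i x t + d i x t))" for i yt yx yxx
    have "\<forall>i. \<exists>yt yx yxx. Q i yt yx yxx"
      using sol unfolding strong_solution_def Q_def by blast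
    then obtain yt yx yxx where Q: "\<And>i. Q i (yt i) (yx i) (yxx i)" by metis
    have yt: "locally_L2 L (yt i)"
      and ac_t: "AE x in lborel. x \<in> {0..L} \<longrightarrow> ac_derivative (\<lambda>t. y i x t) (\<lambda>t. yt i x t) {0<..}"
      and ac_x: "AE t in lborel. t > 0 \<longrightarrow>
        ac_derivative (\<lambda>x. y i x t) (\<lambda>x. yx i x t) {0..L} \<and>
        ac_derivative (\<lambda>x. yx i x t) (\<lambda>x. yxx i x t) {0..L}"
      and pde: "AE (x, t) in lborel. x \<in> {0..L} \<and> t > 0 \<longrightarrow>
        yt i x t = k * yxx i x t + (controller A \<alpha> dbar L s y i x t + d i x t)" for i
      using Q[of i] by (simp_all add: Q_def)

    define W where "W i j t = integral {0..L} (\<lambda>x. (y i x t - y j x t)\<^sup>2)" for i j t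
    define V where "V t = 1 / (2 * real CARD('n)) * (\<Sum>i\<in>UNIV. \<Sum>j\<in>UNIV. W i j t)" for t
    define I where "I i j t = (LINT x:{0..L}|lborel. (y i x t - y j x t) * (yt i x t - yt j x t))" for i j t
    have cont_t: "continuous_on {0..L} (\<lambda>x. y i x t)" if "0 < t" for i t
      using that by (intro continuous_on_compose2[OF cont, where f = "\<lambda>x. (x, t)", simplified] continuous_intros) auto
    have cont_diff: "continuous_on ({0..L} \<times> {0<..}) (\<lambda>(x, t). y i x t - y j x t)" for i j
      using continuous_on_diff[OF cont[of i] cont[of j]] by (simp add: case_prod_unfold)
    have cont_W: "continuous_on {0<..} (W i j)" for i j
      unfolding W_def by (rule continuous_on_integral_square[OF cont_diff])
    have int_W: "(\<lambda>x. (y i x t - y j x t)\<^sup>2) integrable_on {0..L}" if "0 < t" for i j t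
      using that by (intro integrable_continuous_real continuous_intros cont_t)
    have W0: "0 \<le> W i j t" if "0 < t" for i j t
      unfolding W_def by (rule Henstock_Kurzweil_Integration.integral_nonneg[OF int_W[OF that]]) simp
    have V_nonneg: "0 \<le> V t" if "0 < t" for t
      unfolding V_def using W0[OF that] by (intro mult_nonneg_nonneg sum_nonneg) auto
    have cont_V: "continuous_on {0<..} V"
      unfolding V_def by (intro continuous_intros cont_W)

    \<comment> \<open>Solutions are continuous only for \<open>t > 0\<close>, so the initial energy
      is reached through \<open>L2\<close> convergence of each agent. The inequality
      \<open>(p - q)^2 \<le> 2 * p^2 + 2 * q^2\<close> passes this on to the differences.\<close>
    have lim_V: "(V \<longlongrightarrow> V0) (at_right 0)"
    proof -
      have pos: "\<forall>\<^sub>F t in at_right (0::real). 0 < t" by (simp add: eventually_at_right_less)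
      have "(W i j \<longlongrightarrow> integral {0..L} (\<lambda>x. (y0 i x - y0 j x)\<^sup>2)) (at_right 0)" for i j
        unfolding W_def
      proof (rule tendsto_integral_square)
        show "\<forall>\<^sub>F t in at_right 0. continuous_on {0..L} (\<lambda>x. y i x t - y j x t)"
          using pos by eventually_elim (intro continuous_intros cont_t)
        show "continuous_on {0..L} (\<lambda>x. y0 i x - y0 j x)" by (intro continuous_intros y0)
        have int: "(\<lambda>x. (y i x t - y0 i x)\<^sup>2) integrable_on {0..L}" if "0 < t" for i t
          using that by (intro integrable_continuous_real continuous_intros cont_t y0)
        have int': "(\<lambda>x. (y i x t - y j x t - (y0 i x - y0 j x))\<^sup>2) integrable_on {0..L}" if "0 < t" for t
          using that by (intro integrable_continuous_real continuous_intros cont_t y0)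
        show "((\<lambda>t. integral {0..L} (\<lambda>x. (y i x t - y j x t - (y0 i x - y0 j x))\<^sup>2)) \<longlongrightarrow> 0) (at_right 0)"
        proof (rule tendsto_sandwich[OF _ _ tendsto_const])
          show "((\<lambda>t. 2 * integral {0..L} (\<lambda>x. (y i x t - y0 i x)\<^sup>2) + 2 * integral {0..L} (\<lambda>x. (y j x t - y0 j x)\<^sup>2)) \<longlongrightarrow> 0) (at_right 0)"
            using tendsto_add[OF tendsto_mult_left[OF init[of i], of 2] tendsto_mult_left[OF init[of j], of 2]] by simp
          show "\<forall>\<^sub>F t in at_right 0. 0 \<le> integral {0..L} (\<lambda>x. (y i x t - y j x t - (y0 i x - y0 j x))\<^sup>2)"
            using pos by eventually_elim (rule Henstock_Kurzweil_Integration.integral_nonneg[OF int'], auto)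
          show "\<forall>\<^sub>F t in at_right 0. integral {0..L} (\<lambda>x. (y i x t - y j x t - (y0 i x - y0 j x))\<^sup>2)
            \<le> 2 * integral {0..L} (\<lambda>x. (y i x t - y0 i x)\<^sup>2) + 2 * integral {0..L} (\<lambda>x. (y j x t - y0 j x)\<^sup>2)"
            using pos
          proof eventually_elim
            fix t :: real assume t: "0 < t"
            have "integral {0..L} (\<lambda>x. (y i x t - y j x t - (y0 i x - y0 j x))\<^sup>2)
              \<le> integral {0..L} (\<lambda>x. 2 * (y i x t - y0 i x)\<^sup>2 + 2 * (y j x t - y0 j x)\<^sup>2)"
            proof (rule integral_le[OF int'[OF t]])
              show "(\<lambda>x. 2 * (y i x t - y0 i x)\<^sup>2 + 2 * (y j x t - y0 j x)\<^sup>2) integrable_on {0..L}"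
                by (intro integrable_add integrable_on_mult_right int t)
              fix x
              have "0 \<le> ((y i x t - y0 i x) + (y j x t - y0 j x))\<^sup>2" by simp
              then show "(y i x t - y j x t - (y0 i x - y0 j x))\<^sup>2 \<le> 2 * (y i x t - y0 i x)\<^sup>2 + 2 * (y j x t - y0 j x)\<^sup>2"
                by (simp add: power2_eq_square algebra_simps)
            qed
            also have "\<dots> = 2 * integral {0..L} (\<lambda>x. (y i x t - y0 i x)\<^sup>2) + 2 * integral {0..L} (\<lambda>x. (y j x t - y0 j x)\<^sup>2)"
              by (subst Henstock_Kurzweil_Integration.integral_add) (auto intro!: integrable_on_mult_right int t)
            finally show "integral {0..L} (\<lambda>x. (y i x t - y j x t - (y0 i x - y0 j x))\<^sup>2)
              \<le> 2 * integral {0..L} (\<lambda>x. (y i x t - y0 i x)\<^sup>2) + 2 * integral {0..L} (\<lambda>x. (y j x t - y0 j x)\<^sup>2)" .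
          qed
        qed
      qed
      then have "(V \<longlongrightarrow> 1 / (2 * real CARD('n)) * (\<Sum>i\<in>UNIV. \<Sum>j\<in>UNIV. integral {0..L} (\<lambda>x. (y0 i x - y0 j x)\<^sup>2))) (at_right 0)"
        unfolding V_def by (intro tendsto_intros)
      moreover have "(\<lambda>x. (y0 i x - y0 j x)\<^sup>2) integrable_on {0..L}" for i j
        by (intro integrable_continuous_real continuous_intros y0)
      then have "V0 = 1 / (2 * real CARD('n)) * (\<Sum>i\<in>UNIV. \<Sum>j\<in>UNIV. integral {0..L} (\<lambda>x. (y0 i x - y0 j x)\<^sup>2))"
        by (simp add: V0_def Henstock_Kurzweil_Integration.integral_sum integrable_sum)
      ultimately show ?thesis by simp
    qed

    \<comment> \<open>A positive \<open>a\<close> keeps the rectangle away from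
      \<open>t = 0\<close>, where the square integrability of the derivatives may fail.\<close>
    have diss: "V b - V a \<le> - C * integral {a..b} (\<lambda>t. V t powr \<alpha>)" if ab: "0 < a" "a \<le> b" for a b
    proof -
      have sub: "{0..L} \<times> {a..b} \<subseteq> {0..L} \<times> {0<..}" using ab by auto
      have yt_int: "set_integrable lborel ({0..L} \<times> {a..b}) (\<lambda>(x, t). yt i x t - yt j x t)" for i j
        using set_integral_diff(1)[OF locally_L2_integrable[OF yt ab(1)] locally_L2_integrable[OF yt ab(1)]]
        by (simp add: case_prod_unfold)
      have ac_ab: "AE x in lborel. x \<in> {0..L} \<longrightarrow>
          ac_derivative (\<lambda>t. y i x t - y j x t) (\<lambda>t. yt i x t - yt j x t) {a..b}" for i j
        using ac_t[of i] ac_t[of j]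
        by eventually_elim (use ab in \<open>auto intro!: ac_derivative_diff elim!: ac_derivative_subset\<close>)
      note E = energy_identity[OF less_imp_le[OF L] ab(2) continuous_on_subset[OF cont_diff sub] yt_int ac_ab, folded I_def W_def]
      have yt_slice: "AE t in lborel. t \<in> {a..b} \<longrightarrow> set_integrable lborel {0..L} (\<lambda>x. yt i x t)" for i
      proof -
        have "0 < a" using ab by simp
        from lborel_slice_integrable[OF locally_L2_integrable[OF yt this]] show ?thesis .
      qed
      \<comment> \<open>The exceptional null sets of the finitely many nodes are merged, so that one
        time \<open>t\<close> serves all nodes at once.\<close>
      have "AE t in lborel. \<forall>i. t > 0 \<longrightarrow>
          ac_derivative (\<lambda>x. y i x t) (\<lambda>x. yx i x t) {0..L} \<and> ac_derivative (\<lambda>x. yx i x t) (\<lambda>x. yxx i x t) {0..L}"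
        using ac_x unfolding AE_all_countable by blast
      moreover have "AE t in lborel. \<forall>i. t \<in> {a..b} \<longrightarrow> set_integrable lborel {0..L} (\<lambda>x. yt i x t)"
        using yt_slice unfolding AE_all_countable by blast
      moreover have "AE (x, t) in lborel. \<forall>i. x \<in> {0..L} \<and> t > 0 \<longrightarrow>
          yt i x t = k * yxx i x t + (controller A \<alpha> dbar L s y i x t + d i x t)"
        using pde unfolding case_prod_unfold AE_all_countable by blast
      then have "AE t in lborel. AE x in lborel. \<forall>i. x \<in> {0..L} \<and> t > 0 \<longrightarrow>
          yt i x t = k * yxx i x t + (controller A \<alpha> dbar L s y i x t + d i x t)"
        by (rule AE_lborel_slices)
      ultimately have I_le: "AE t \<in> {a..b} in lborel.
          1 / real CARD('n) * (\<Sum>i\<in>UNIV. \<Sum>j\<in>UNIV. I i j t) \<le> - C * V t powr \<alpha>"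
      proof eventually_elim
        fix t assume ac: "\<forall>i. t > 0 \<longrightarrow>
            ac_derivative (\<lambda>x. y i x t) (\<lambda>x. yx i x t) {0..L} \<and> ac_derivative (\<lambda>x. yx i x t) (\<lambda>x. yxx i x t) {0..L}"
          and p: "\<forall>i. t \<in> {a..b} \<longrightarrow> set_integrable lborel {0..L} (\<lambda>x. yt i x t)"
          and eq: "AE x in lborel. \<forall>i. x \<in> {0..L} \<and> t > 0 \<longrightarrow>
            yt i x t = k * yxx i x t + (controller A \<alpha> dbar L s y i x t + d i x t)"
        show "t \<in> {a..b} \<longrightarrow> 1 / real CARD('n) * (\<Sum>i\<in>UNIV. \<Sum>j\<in>UNIV. I i j t) \<le> - C * V t powr \<alpha>"
        proof
          assume t: "t \<in> {a..b}"
          then have t0: "0 < t" using ab by simp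
          have "(\<Sum>i\<in>UNIV. \<Sum>j\<in>UNIV. I i j t)
              \<le> - real CARD('n) * (\<Sum>i\<in>UNIV. \<Sum>j\<in>UNIV. A $ i $ j * W i j t powr \<alpha>)"
            unfolding I_def
          proof (rule dissipation_slice[where D = "\<lambda>i x. d i x t" and \<sigma> = "\<lambda>i j x. s i j x t"
                and vx = "\<lambda>i x. yx i x t" and vxx = "\<lambda>i x. yxx i x t"])
            show "AE x in lborel. \<forall>i. x \<in> {0..L} \<longrightarrow> yt i x t = k * yxx i x t +
                (- (\<Sum>j\<in>UNIV. A $ i $ j * W i j t powr (\<alpha> - 1) * (y i x t - y j x t))
                 - dbar * (\<Sum>j\<in>UNIV. A $ i $ j * s i j x t) + d i x t)"
              using eq t0 unfolding controller_def xi_def W_def by simp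
            show "\<bar>d i x t\<bar> \<le> dmax" if "x \<in> {0..L}" for i x
              using d[OF that] t0 by simp
            show "s i j x t = sgn (y i x t - y j x t)" if "y i x t \<noteq> y j x t" for i j x
              using s that unfolding sign_values_def xi_def by (metis right_minus_eq)
            show "s j i x t = - s i j x t" for i j x
              using s unfolding sign_values_def by blast
            show "ac_derivative (\<lambda>x. y i x t) (\<lambda>x. yx i x t) {0..L}"
              "ac_derivative (\<lambda>x. yx i x t) (\<lambda>x. yxx i x t) {0..L}" for i
              using ac t0 by simp_all
            show "set_integrable lborel {0..L} (\<lambda>x. yt i x t)" for i
              using p t by simp
            show "y i 0 t = 0" "y i L t = 0" for i
              using bc t0 by simp_all
          qed (use L k A lamE dbar in \<open>simp_all add: W_def\<close>)
          then have "1 / real CARD('n) * (\<Sum>i\<in>UNIV. \<Sum>j\<in>UNIV. I i j t)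
              \<le> - (\<Sum>i\<in>UNIV. \<Sum>j\<in>UNIV. A $ i $ j * W i j t powr \<alpha>)"
            by (simp add: field_simps)
          moreover have "C * V t powr \<alpha> \<le> (\<Sum>i\<in>UNIV. \<Sum>j\<in>UNIV. A $ i $ j * W i j t powr \<alpha>)"
            unfolding C_def V_def using \<alpha> A(1) lamB cont_t[OF t0] W_def
            by (intro coupling_ge_lambda2[where v = "\<lambda>i x. y i x t"]) auto
          ultimately show "1 / real CARD('n) * (\<Sum>i\<in>UNIV. \<Sum>j\<in>UNIV. I i j t) \<le> - C * V t powr \<alpha>" by simp
        qed
      qed
      have cont_Va: "continuous_on {a..b} (\<lambda>t. V t powr \<alpha>)"
        using ab V_nonneg \<alpha> by (intro continuous_on_powr' continuous_intros continuous_on_subset[OF cont_V]) auto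
      note int_Va = borel_integrable_atLeastAtMost'[OF cont_Va]
      \<comment> \<open>The factor 2 from the energy identity cancels against \<open>1/(2N)\<close>;
        the remaining \<open>1/N\<close> cancels the \<open>N\<close> in the dissipation
        estimate.\<close>
      have "V b - V a = 1 / (2 * real CARD('n)) * (\<Sum>i\<in>UNIV. \<Sum>j\<in>UNIV. W i j b - W i j a)"
        by (simp add: V_def sum_subtractf right_diff_distrib diff_divide_distrib)
      also have "\<dots> = (LINT t:{a..b}|lborel. 1 / real CARD('n) * (\<Sum>i\<in>UNIV. \<Sum>j\<in>UNIV. I i j t))"
        by (simp add: E(2) set_integral_sum E(1) flip: sum_distrib_left)
      also have "\<dots> \<le> (LINT t:{a..b}|lborel. - C * V t powr \<alpha>)"
        by (rule set_integral_mono_AE[OF _ _ I_le]) (intro set_integrable_mult_right set_integral_sum(1) E(1) int_Va)+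
      also have "\<dots> = - C * integral {a..b} (\<lambda>t. V t powr \<alpha>)"
        by (simp only: set_integral_mult_right set_borel_integral_eq_integral(2)[OF int_Va])
      finally show ?thesis .
    qed

    have V_zero: "V t = 0" if "0 < t" "T \<le> t" for t
      using finite_time_extinction[OF \<alpha> C cont_V V_nonneg lim_V diss that(1)] that(2) by (simp add: T_def)
    \<comment> \<open>A continuous nonnegative function with integral 0 over the nondegenerate
      interval \<open>{0..L}\<close> vanishes everywhere, so zero energy forces pointwise
      agreement.\<close>
    have agree: "y i x t = y j x t" if t: "0 < t" "T \<le> t" and x: "x \<in> {0..L}" for i j x t
    proof -
      have "(\<Sum>i\<in>UNIV. \<Sum>j\<in>UNIV. W i j t) = 0"
        using V_zero[OF t] by (simp add: V_def)
      then have "W i j t = 0"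
        using W0[OF t(1)] by (simp add: sum_nonneg_eq_0_iff sum_nonneg)
      moreover have "continuous_on {0..L} (\<lambda>x. (y i x t - y j x t)\<^sup>2)"
        by (intro continuous_intros cont_t t)
      ultimately have "(y i x t - y j x t)\<^sup>2 = 0"
        using integral_eq_0_iff[of 0 L "\<lambda>x. (y i x t - y j x t)\<^sup>2"] L x by (simp add: W_def)
      then show ?thesis by simp
    qed
    have T0: "0 \<le> T" using C \<alpha> by (simp add: T_def)
    show ?thesis
      unfolding consensus_time_def
    proof (intro conjI ballI allI T0)
      fix x i j assume x: "x \<in> {0..L}"
      show "((\<lambda>t. \<bar>y i x t - y j x t\<bar>) \<longlongrightarrow> 0) (at T within {0..})"
      proof (cases "T = 0")
        case True
        have "\<forall>\<^sub>F t in at T within {0..}. \<bar>y i x t - y j x t\<bar> = 0"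
          unfolding eventually_at_filter using agree[OF _ _ x] True by (intro always_eventually) auto
        then show ?thesis by (rule tendsto_eventually)
      next
        \<comment> \<open>Before \<open>T\<close> the agents may still differ. The limit from the
          left comes from continuity in \<open>t\<close> together with agreement at \<open>T\<close>
          itself.\<close>
        case False
        then have T: "0 < T" using T0 by simp
        have "continuous_on {0<..} (\<lambda>t. y i x t - y j x t)"
          using x by (intro continuous_on_compose2[OF cont_diff, where f = "\<lambda>t. (x, t)", simplified] continuous_intros) auto
        then have "isCont (\<lambda>t. y i x t - y j x t) T"
          using T by (simp add: continuous_on_eq_continuous_at)
        then have "((\<lambda>t. y i x t - y j x t) \<longlongrightarrow> 0) (at T)"
          using agree[OF T order_refl x, of i j] by (simp add: isCont_def)
        then show ?thesis
          by (intro tendsto_rabs_zero) (rule tendsto_within_subset[of _ _ _ UNIV], auto)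
      qed
    qed
  qed
  then show ?thesis
    unfolding finite_time_consensus_def T_def V0_def C_def by blast
qed

end
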